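(* Let $\mathcal{P}$ denote the class of all pairs $(K,L)$ of smooth, strictly convex planar convex bodies $K,L\subset\mathbb{R}^2$, each containing the origin in its interior, such that $K$ and $L$ are at a dilation position. Then the following three statements are equivalent: (i) (Uniqueness for cone-volume measures) For all $(K,L)\in\mathcal{P}$, if $V_K=V_L$ as Borel measures on $\mathbb{S}^1$, then $K=L$. (ii) (Log-Minkowski inequality of volume) For all $(K,L)\in\mathcal{P}$, $$\int_{\mathbb{S}^{1}}\log\frac{h_L}{h_K}\,dV_K\ge\frac{V(K)}{2}\log\frac{V(L)}{V(K)},$$ with equality if and only if $K$ and $L$ are dilates. (iii) (Log-Minkowski inequality of curvature entropy) For all $(K,L)\in\mathcal{P}$, $$E(K,L)\le\frac{V(K)}{2}\log\frac{V(L)}{V(K)},$$ with equality if and only if $K$ and $L$ are homothetic.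
   Context: A convex body in $\mathbb{R}^n$ is a compact convex subset with non-empty interior; $V$ denotes $n$-dimensional volume (area when $n=2$). The support function of $K$ is $h_K(x)=\max\{x\cdot y: y\in K\}$; when $n=2$, regard $h_K$ as a $2\pi$-periodic function of the angle $\theta$ of the unit vector $u=(\cos\theta,\sin\theta)$, with primes denoting derivatives in $\theta$. Cone-volume measure: for a convex body $K\subset\mathbb{R}^n$ containing the origin in its interior, $V_K$ is the Borel measure on the unit sphere $\mathbb{S}^{n-1}$ with $dV_K=\frac1n h_K\,dS_K$, where $S_K$ is the surface area measure of $K$. For smooth planar $K$, $dV_K=\frac12 h_K(h_K+h_K'')\,d\theta$. Curvature entropy (planar case): $$E(K,L)=-\int_{\mathbb{S}^{1}}\log\frac{\kappa_L}{\kappa_K}\,dV_K,$$ where $\kappa_K(u)$ is the curvature of $\partial K$ at the boundary point with outer unit normal $u$, so that $1/\kappa_K=h_K+h_K''$, and hence $\frac{\kappa_L}{\kappa_K}=\frac{h_K+h_K''}{h_L+h_L''}$. The boundaries have positive curvature, so that these expressions are well defined. Dilation position: $K$ and $L$ are at a dilation position if the origin $o\in K\cap L$ and $r(K,L)\,L\subset K\subset R(K,L)\,L$, where $r(K,L)=\max\{t>0: x+tL\subset K \text{ for some } x\in\mathbb{R}^n\}$ and $R(K,L)=\min\{t>0: x+tL\supset K\text{ for some }x\in\mathbb{R}^n\}$. $K$ and $L$ are dilates if $K=cL$ for some $c>0$; they are homothetic if $K=cL+x$ for some $c>0$ and some vector $x$. *)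

theory Defs
  imports "HOL-Analysis.Analysis"
begin

definition unit_vec :: "real \<Rightarrow> real^2" where
  "unit_vec \<theta> = vector [cos \<theta>, sin \<theta>]"

definition convex_body :: "(real^2) set \<Rightarrow> bool" where
  "convex_body K \<longleftrightarrow> compact K \<and> convex K \<and> interior K \<noteq> {}"

definition strictly_convex :: "(real^2) set \<Rightarrow> bool" where
  "strictly_convex K \<longleftrightarrow>
     convex K \<and> (\<forall>x\<in>K. \<forall>y\<in>K. x \<noteq> y \<longrightarrow> open_segment x y \<subseteq> interior K)"

text \<open>For compact nonempty \<open>K\<close> the supremum is attained, so it is a maximum.\<close>

definition support_fun :: "(real^2) set \<Rightarrow> real^2 \<Rightarrow> real" where
  "support_fun K x = (SUP y\<in>K. x \<bullet> y)"

definition support_angle :: "(real^2) set \<Rightarrow> real \<Rightarrow> real" where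
  "support_angle K \<theta> = support_fun K (unit_vec \<theta>)"

definition velocity :: "(real \<Rightarrow> real^2) \<Rightarrow> real \<Rightarrow> real^2" where
  "velocity \<gamma> t = vector_derivative \<gamma> (at t)"

text \<open>Infinite differentiability: every iterated derivative is differentiable everywhere.\<close>

definition smooth_curve :: "(real \<Rightarrow> real^2) \<Rightarrow> bool" where
  "smooth_curve \<gamma> \<longleftrightarrow> (\<forall>n t. (velocity ^^ n) \<gamma> differentiable at t)"

definition signed_curvature :: "(real \<Rightarrow> real^2) \<Rightarrow> real \<Rightarrow> real" where
  "signed_curvature \<gamma> t =
     (let v = velocity \<gamma> t; a = velocity (velocity \<gamma>) t
      in (v$1 * a$2 - v$2 * a$1) / norm v ^ 3)"

text \<open>
  \<open>\<gamma>\<close> is a smooth regular simple closed parametrization of the boundary of \<open>K\<close>. The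
  positivity of the signed curvature says that the boundary has positive curvature, and
  selects the counterclockwise parametrizations among all regular ones.
\<close>

definition boundary_param :: "(real^2) set \<Rightarrow> (real \<Rightarrow> real^2) \<Rightarrow> bool" where
  "boundary_param K \<gamma> \<longleftrightarrow>
     smooth_curve \<gamma> \<and>
     (\<forall>t. \<gamma> (t + 2 * pi) = \<gamma> t) \<and>
     inj_on \<gamma> {0..<2 * pi} \<and>
     range \<gamma> = frontier K \<and>
     (\<forall>t. velocity \<gamma> t \<noteq> 0) \<and>
     (\<forall>t. signed_curvature \<gamma> t > 0)"

definition smooth_body :: "(real^2) set \<Rightarrow> bool" where
  "smooth_body K \<longleftrightarrow> (\<exists>\<gamma>. boundary_param K \<gamma>)"

text \<open>
  Curvature at the boundary point with outer unit normal \<open>u\<close>; the condition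
  \<open>u \<bullet> \<gamma> t = support_fun K u\<close> says that \<open>u\<close> is an outer normal at \<open>\<gamma> t\<close>.
  The value depends neither on the parametrization nor on the parameter \<open>t\<close>.
\<close>

definition curvature :: "(real^2) set \<Rightarrow> real^2 \<Rightarrow> real" where
  "curvature K u =
     (THE k. \<exists>\<gamma> t. boundary_param K \<gamma> \<and> u \<bullet> \<gamma> t = support_fun K u \<and>
        k = signed_curvature \<gamma> t)"

definition circle :: "(real^2) measure" where
  "circle = restrict_space borel (sphere 0 1)"

text \<open>
  Surface area measure of a smooth body: \<open>dS = (h + h'') d\<theta>\<close>, carried over from
  the angle \<open>\<theta>\<close> to the unit circle.
\<close>

definition surface_area_measure :: "(real^2) set \<Rightarrow> (real^2) measure" where
  "surface_area_measure K =
     distr (density (restrict_space lborel {0..<2 * pi})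
              (\<lambda>\<theta>. ennreal (support_angle K \<theta> + deriv (deriv (support_angle K)) \<theta>)))
       circle unit_vec"

definition cone_volume_measure :: "(real^2) set \<Rightarrow> (real^2) measure" where
  "cone_volume_measure K =
     density (surface_area_measure K) (\<lambda>u. ennreal (support_fun K u / 2))"

definition curvature_entropy :: "(real^2) set \<Rightarrow> (real^2) set \<Rightarrow> real" where
  "curvature_entropy K L =
     - (\<integral>u. ln (curvature L u / curvature K u) \<partial>cone_volume_measure K)"

text \<open>
  For convex bodies the supremum and the infimum below are attained, so they are the
  maximum and the minimum.
\<close>

definition rel_inradius :: "(real^2) set \<Rightarrow> (real^2) set \<Rightarrow> real" where
  "rel_inradius K L = Sup {t. t > 0 \<and> (\<exists>x. (\<lambda>y. x + t *\<^sub>R y) ` L \<subseteq> K)}"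

definition rel_outradius :: "(real^2) set \<Rightarrow> (real^2) set \<Rightarrow> real" where
  "rel_outradius K L = Inf {t. t > 0 \<and> (\<exists>x. K \<subseteq> (\<lambda>y. x + t *\<^sub>R y) ` L)}"

definition dilation_position :: "(real^2) set \<Rightarrow> (real^2) set \<Rightarrow> bool" where
  "dilation_position K L \<longleftrightarrow>
     0 \<in> K \<inter> L \<and>
     (\<lambda>y. rel_inradius K L *\<^sub>R y) ` L \<subseteq> K \<and>
     K \<subseteq> (\<lambda>y. rel_outradius K L *\<^sub>R y) ` L"

definition dilates :: "(real^2) set \<Rightarrow> (real^2) set \<Rightarrow> bool" where
  "dilates K L \<longleftrightarrow> (\<exists>c>0. K = (\<lambda>y. c *\<^sub>R y) ` L)"

definition homothetic :: "(real^2) set \<Rightarrow> (real^2) set \<Rightarrow> bool" where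
  "homothetic K L \<longleftrightarrow> (\<exists>c>0. \<exists>x. K = (\<lambda>y. c *\<^sub>R y + x) ` L)"

definition admissible_body :: "(real^2) set \<Rightarrow> bool" where
  "admissible_body K \<longleftrightarrow>
     convex_body K \<and> smooth_body K \<and> strictly_convex K \<and> 0 \<in> interior K"

definition admissible_pairs :: "((real^2) set \<times> (real^2) set) set" where
  "admissible_pairs =
     {(K, L). admissible_body K \<and> admissible_body L \<and> dilation_position K L}"

end

theory Submission
  imports Defs
begin

text \<open>
  All three statements hold, so they are proved rather than derived from each other. Write
  \<open>a = h\<^sub>K\<close>, \<open>b = h\<^sub>L\<close>, \<open>\<rho>\<^sub>f = f + f''\<close> and \<open>V(f, g) = 1/2 \<integral> f \<rho>\<^sub>g\<close>.
  If \<open>r\<close> and \<open>R\<close> are the relative inradius and outradius, then in dilation position the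
  functions \<open>a - r b \<ge> 0\<close> and \<open>R b - a \<ge> 0\<close> vanish somewhere on every closed half circle
  (otherwise a translate of \<open>r L\<close> or \<open>R L\<close> could be improved). By Wirtinger's inequality on
  the gaps between zeros, \<open>V(a - t b, a - t b) \<le> 0\<close> for \<open>t = r, R\<close>, hence by convexity for all
  \<open>t\<close> in between (Bonnesen-Blaschke). Inserting \<open>t = a / b\<close> pointwise and integrating against
  \<open>b \<rho>\<^sub>a\<close> bounds the integral of \<open>h\<^sub>K / h\<^sub>L\<close> with respect to \<open>V\<^sub>K\<close> by
  \<open>V(K) V(K, L) / V(L)\<close>; in the equality case \<open>a / b\<close> takes its values among the roots of a
  quadratic polynomial and is therefore constant. This gives uniqueness at once and, differentiating
  along \<open>(1 - t) a + t b\<close>, the log-Minkowski inequality of volume. The inequality of curvature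
  entropy follows from that of volume by Jensen's inequality for \<open>ln\<close>.
\<close>

section \<open>Periodic functions of class C2\<close>

text \<open>A zero in every closed half circle bounds the gaps between zeros by \<pi>, and \<pi> is
  precisely the length at which Wirtinger's inequality for functions vanishing at both ends has
  constant 1. The differences \<open>a - t b\<close> are in general not support functions, so the
  calculus is set up for arbitrary periodic functions of class C2, and positivity enters only with
  \<open>regular_support\<close>. The path \<open>(1 - t) a + t b\<close> is chosen because
  \<open>a\<close> minus a suitable multiple of it is a positive multiple of \<open>a - s b\<close>
  for t > 0: contact points and one-sided bounds pass to every pair on the path. The two equality
  cases coincide on admissible pairs: equality for the entropy forces equality for the volume, hence
  dilates, while a translation changes neither radii of curvature nor area. Geometry is confined to
  a dictionary: inclusions and homotheties are read off from support functions,
  \<open>f + f''\<close> is the radius of curvature, \<open>V(f, f)\<close> is the area, integrals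
  over the circle become integrals in the angle, and extremality of r and R produces the contact
  points.\<close>

lemma periodic_shift_int:
  fixes f :: "real \<Rightarrow> 'a"
  assumes "\<And>x. f (x + 2 * pi) = f x"
  shows "f (x + 2 * pi * of_int k) = f x"
proof -
  have nat: "f (x + 2 * pi * real n) = f x" for n x
  proof (induction n)
    case (Suc n)
    have "f (x + 2 * pi * real (Suc n)) = f (x + 2 * pi * real n + 2 * pi)"
      by (rule arg_cong[of _ _ f]) (simp add: algebra_simps)
    then show ?case using Suc assms by simp
  qed simp
  show ?thesis
  proof (cases "k \<ge> 0")
    case True
    then show ?thesis using nat[of x "nat k"] by simp
  next
    case False
    then show ?thesis using nat[of "x + 2 * pi * of_int k" "nat (- k)"] by (simp add: algebra_simps)
  qed
qed

lemma periodic_reduce: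
  obtains k :: int where "c \<le> x + 2 * pi * of_int k" "x + 2 * pi * of_int k < c + 2 * pi"
proof -
  define k where "k = \<lceil>(c - x) / (2 * pi)\<rceil>"
  have "(c - x) / (2 * pi) \<le> of_int k" "of_int k < (c - x) / (2 * pi) + 1"
    unfolding k_def by linarith+
  then have "(c - x) / (2 * pi) * (2 * pi) \<le> of_int k * (2 * pi)"
      "of_int k * (2 * pi) < ((c - x) / (2 * pi) + 1) * (2 * pi)"
    by (intro mult_right_mono mult_strict_right_mono; simp)+
  moreover have "(c - x) / (2 * pi) * (2 * pi) = c - x" by (rule nonzero_eq_divide_eq[THEN iffD1]) auto
  ultimately have "c - x \<le> of_int k * (2 * pi)" "of_int k * (2 * pi) < c - x + 2 * pi"
    unfolding distrib_right by simp_all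
  then show ?thesis by (intro that[of k]) (simp_all add: mult.commute)
qed

lemma periodic_range:
  fixes f :: "real \<Rightarrow> 'a"
  assumes "\<And>x. f (x + 2 * pi) = f x"
  obtains y where "c \<le> y" "y < c + 2 * pi" "f y = f x"
  using periodic_reduce[of c x] periodic_shift_int[of f, OF assms] by metis

lemma periodic_integral:
  fixes F :: "real \<Rightarrow> real"
  assumes cont: "continuous_on UNIV F" and per: "\<And>x. F (x + 2 * pi) = F x"
    and z: "0 \<le> z" "z \<le> 2 * pi"
  shows "integral {z..z + 2 * pi} F = integral {0..2 * pi} F"
proof -
  have int: "F integrable_on {a..b}" for a b
    by (rule integrable_continuous_real[OF continuous_on_subset[OF cont]]) auto
  have "integral {z..z + 2 * pi} F = integral {z..2 * pi} F + integral {2 * pi..z + 2 * pi} F"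
    by (rule Henstock_Kurzweil_Integration.integral_combine[symmetric]) (use z int in auto)
  also have "integral {2 * pi..z + 2 * pi} F = integral {0..z} F"
    using integral_shift_Icc_real[of 0 z F "2 * pi"] per by (simp add: add.commute o_def)
  also have "integral {z..2 * pi} F + integral {0..z} F = integral {0..2 * pi} F"
    using Henstock_Kurzweil_Integration.integral_combine[of 0 z "2 * pi" F] z int by auto
  finally show ?thesis .
qed

text \<open>A linear space, so that it contains differences of support functions.\<close>

definition C2_periodic :: "(real \<Rightarrow> real) \<Rightarrow> bool" where
  "C2_periodic f \<longleftrightarrow> (\<forall>x. f differentiable at x) \<and> (\<forall>x. deriv f differentiable at x) \<and>
     continuous_on UNIV (deriv (deriv f)) \<and> (\<forall>x. f (x + 2 * pi) = f x)"

text \<open>For the support function of a smooth body this is the reciprocal of the curvature at the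
  point with normal angle x; for differences of support functions it may have any sign.\<close>

definition curv_radius :: "(real \<Rightarrow> real) \<Rightarrow> real \<Rightarrow> real" where
  "curv_radius f x = f x + deriv (deriv f) x"

definition mixed_area :: "(real \<Rightarrow> real) \<Rightarrow> (real \<Rightarrow> real) \<Rightarrow> real" where
  "mixed_area f g = integral {0..2 * pi} (\<lambda>x. f x * curv_radius g x) / 2"

lemma C2_periodicI:
  assumes "\<And>x. (f has_real_derivative f' x) (at x)" "\<And>x. (f' has_real_derivative f'' x) (at x)"
    "continuous_on UNIV f''" "\<And>x. f (x + 2 * pi) = f x"
  shows "C2_periodic f" "deriv f = f'" "deriv (deriv f) = f''"
proof -
  show 1: "deriv f = f'" using assms(1) by (auto intro!: DERIV_imp_deriv)
  show 2: "deriv (deriv f) = f''" unfolding 1 using assms(2) by (auto intro!: DERIV_imp_deriv)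
  show "C2_periodic f" unfolding C2_periodic_def 2 unfolding 1
    using assms real_differentiable_def by blast
qed

context
  fixes f assumes f: "C2_periodic f"
begin

lemma C2_periodic_deriv: "(f has_real_derivative deriv f x) (at x)"
  using f DERIV_deriv_iff_real_differentiable unfolding C2_periodic_def by blast

lemma C2_periodic_deriv2: "(deriv f has_real_derivative deriv (deriv f) x) (at x)"
  using f DERIV_deriv_iff_real_differentiable unfolding C2_periodic_def by blast

lemma C2_periodic_shift: "f (x + 2 * pi) = f x"
  using f unfolding C2_periodic_def by blast

lemma C2_periodic_shift_deriv: "deriv f (x + 2 * pi) = deriv f x"
proof -
  have "((\<lambda>x. f (x + 2 * pi)) has_real_derivative deriv f (x + 2 * pi)) (at x)"
    using DERIV_shift[of f "deriv f (x + 2 * pi)" x "2 * pi"] C2_periodic_deriv by simp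
  then show ?thesis
    using C2_periodic_deriv C2_periodic_shift by (simp add: DERIV_unique)
qed

lemma C2_periodic_shift_deriv2: "deriv (deriv f) (x + 2 * pi) = deriv (deriv f) x"
proof -
  have "((\<lambda>x. deriv f (x + 2 * pi)) has_real_derivative deriv (deriv f) (x + 2 * pi)) (at x)"
    using DERIV_shift[of "deriv f" "deriv (deriv f) (x + 2 * pi)" x "2 * pi"] C2_periodic_deriv2 by simp
  then show ?thesis
    using C2_periodic_deriv2 C2_periodic_shift_deriv by (simp add: DERIV_unique)
qed

lemma C2_periodic_continuous: "continuous_on S f"
  by (meson C2_periodic_deriv DERIV_continuous_on has_field_derivative_at_within)

lemma C2_periodic_continuous_deriv: "continuous_on S (deriv f)"
  by (meson C2_periodic_deriv2 DERIV_continuous_on has_field_derivative_at_within)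

lemma C2_periodic_continuous_deriv2: "continuous_on S (deriv (deriv f))"
  using f unfolding C2_periodic_def by (meson continuous_on_subset top_greatest)

lemma C2_periodic_continuous_curv_radius: "continuous_on S (curv_radius f)"
  unfolding curv_radius_def
  by (intro continuous_intros C2_periodic_continuous C2_periodic_continuous_deriv2)

lemma curv_radius_shift: "curv_radius f (x + 2 * pi) = curv_radius f x"
  unfolding curv_radius_def by (simp add: C2_periodic_shift C2_periodic_shift_deriv2)

end

lemmas C2_periodic_continuous_intros =
  C2_periodic_continuous C2_periodic_continuous_deriv C2_periodic_continuous_deriv2
  C2_periodic_continuous_curv_radius

lemma C2_periodic_lincomb:
  assumes f: "C2_periodic f" and g: "C2_periodic g"
  shows "C2_periodic (\<lambda>x. c * f x + d * g x)"
    and "curv_radius (\<lambda>x. c * f x + d * g x) x = c * curv_radius f x + d * curv_radius g x"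
proof -
  let ?h = "\<lambda>x. c * f x + d * g x"
  have 1: "(?h has_real_derivative c * deriv f x + d * deriv g x) (at x)" for x
    by (auto intro!: derivative_eq_intros C2_periodic_deriv f g)
  have 2: "((\<lambda>x. c * deriv f x + d * deriv g x) has_real_derivative
      c * deriv (deriv f) x + d * deriv (deriv g) x) (at x)" for x
    by (auto intro!: derivative_eq_intros C2_periodic_deriv2 f g)
  have 3: "continuous_on UNIV (\<lambda>x. c * deriv (deriv f) x + d * deriv (deriv g) x)"
    by (intro continuous_intros C2_periodic_continuous_intros f g)
  have 4: "?h (x + 2 * pi) = ?h x" for x
    by (simp add: C2_periodic_shift[OF f] C2_periodic_shift[OF g])
  note * = C2_periodicI[of ?h "\<lambda>x. c * deriv f x + d * deriv g x", OF 1 2 3 4]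
  show "C2_periodic ?h" by (rule *(1))
  show "curv_radius ?h x = c * curv_radius f x + d * curv_radius g x"
    unfolding curv_radius_def *(3) by (simp add: algebra_simps)
qed

section \<open>Mixed area as a symmetric bilinear form\<close>

lemma mixed_area_has_integral:
  assumes f: "C2_periodic f" and g: "C2_periodic g"
  shows "((\<lambda>x. f x * curv_radius g x) has_integral 2 * mixed_area f g) {0..2 * pi}"
proof -
  have "(\<lambda>x. f x * curv_radius g x) integrable_on {0..2 * pi}"
    by (intro integrable_continuous_real continuous_intros C2_periodic_continuous_intros f g)
  then show ?thesis unfolding mixed_area_def by (simp add: integrable_integral)
qed

text \<open>The boundary term of \<open>f * deriv g\<close> cancels over a period. The result is
  symmetric in f and g, and for f = g it is the difference of the two sides of Wirtinger's
  inequality.\<close>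

lemma mixed_area_by_parts:
  assumes f: "C2_periodic f" and g: "C2_periodic g"
  shows "((\<lambda>x. f x * g x - deriv f x * deriv g x) has_integral 2 * mixed_area f g) {0..2 * pi}"
proof -
  let ?D = "\<lambda>x. deriv f x * deriv g x + f x * deriv (deriv g) x"
  have "(?D has_integral (f (2 * pi) * deriv g (2 * pi) - f 0 * deriv g 0)) {0..2 * pi}"
    by (rule fundamental_theorem_of_calculus)
      (auto simp: has_real_derivative_iff_has_vector_derivative[symmetric]
        intro!: derivative_eq_intros has_field_derivative_at_within[OF C2_periodic_deriv]
         has_field_derivative_at_within[OF C2_periodic_deriv2] f g)
  then have "(?D has_integral 0) {0..2 * pi}"
    using C2_periodic_shift[OF f, of 0] C2_periodic_shift_deriv[OF g, of 0] by simp
  from has_integral_diff[OF mixed_area_has_integral[OF f g] this] show ?thesis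
    by (simp add: curv_radius_def algebra_simps)
qed

lemma mixed_area_commute:
  assumes "C2_periodic f" "C2_periodic g"
  shows "mixed_area f g = mixed_area g f"
  using mixed_area_by_parts[OF assms] mixed_area_by_parts[OF assms(2,1)]
  by (simp add: mult.commute has_integral_iff)

lemma mixed_area_lincomb_left:
  assumes "C2_periodic f" "C2_periodic g" "C2_periodic h"
  shows "mixed_area (\<lambda>x. c * f x + d * g x) h = c * mixed_area f h + d * mixed_area g h"
proof -
  have "((\<lambda>x. c * (f x * curv_radius h x) + d * (g x * curv_radius h x))
      has_integral c * (2 * mixed_area f h) + d * (2 * mixed_area g h)) {0..2 * pi}"
    by (intro has_integral_add has_integral_mult_right mixed_area_has_integral assms)
  moreover have "((\<lambda>x. (c * f x + d * g x) * curv_radius h x)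
      has_integral 2 * mixed_area (\<lambda>x. c * f x + d * g x) h) {0..2 * pi}"
    by (intro mixed_area_has_integral C2_periodic_lincomb assms)
  ultimately show ?thesis
    by (simp add: has_integral_iff algebra_simps)
qed

lemma mixed_area_lincomb_right:
  assumes "C2_periodic f" "C2_periodic g" "C2_periodic h"
  shows "mixed_area h (\<lambda>x. c * f x + d * g x) = c * mixed_area h f + d * mixed_area h g"
  using mixed_area_lincomb_left[OF assms] assms
  by (simp add: mixed_area_commute[of h] C2_periodic_lincomb)

lemma mixed_area_lincomb_self:
  assumes "C2_periodic f" "C2_periodic g"
  shows "mixed_area (\<lambda>x. c * f x + d * g x) (\<lambda>x. c * f x + d * g x) =
    c\<^sup>2 * mixed_area f f + 2 * c * d * mixed_area f g + d\<^sup>2 * mixed_area g g"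
  using assms mixed_area_commute[OF assms]
  by (simp add: mixed_area_lincomb_left mixed_area_lincomb_right C2_periodic_lincomb
      power2_eq_square algebra_simps)

section \<open>Wirtinger's inequality\<close>

text \<open>
  With \<open>w = - s tan (s (x - m))\<close>, where \<open>m\<close> is the midpoint and \<open>s < 1\<close>, one has
  \<open>g'\<^sup>2 - s\<^sup>2 g\<^sup>2 - (g\<^sup>2 w)' = (g' - g w)\<^sup>2\<close>; taking \<open>s < 1\<close> keeps \<open>w\<close> bounded
  even if the interval has length \<open>\<pi>\<close>.
\<close>

lemma wirtinger_interval:
  fixes g g' :: "real \<Rightarrow> real"
  assumes der: "\<And>x. (g has_real_derivative g' x) (at x)" and cont: "continuous_on UNIV g'"
    and ab: "\<alpha> \<le> \<beta>" "\<beta> - \<alpha> \<le> pi" and zero: "g \<alpha> = 0" "g \<beta> = 0"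
  shows "integral {\<alpha>..\<beta>} (\<lambda>x. (g x)\<^sup>2) \<le> integral {\<alpha>..\<beta>} (\<lambda>x. (g' x)\<^sup>2)"
\<comment> \<open>The passage to the limit s -> 1 is absorbed here: the inequality follows once its
  left side, multiplied by any z in (0, 1), satisfies it. The s of the remark above is the square
  root of z.\<close>
proof (rule field_le_mult_one_interval)
  fix z :: real assume z: "0 < z" "z < 1"
  define s where "s = sqrt z"
  have s: "0 < s" "s < 1" "s\<^sup>2 = z" using z by (auto simp: s_def)
  define m where "m = (\<alpha> + \<beta>) / 2"
  have cos_pos: "cos (s * (x - m)) > 0" if "x \<in> {\<alpha>..\<beta>}" for x
  proof -
    have "\<bar>x - m\<bar> \<le> pi / 2" using that ab unfolding m_def by (auto simp: abs_if field_simps)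
    then have "s * \<bar>x - m\<bar> < 1 * (pi / 2)"
      using s pi_half_gt_zero mult_strict_right_mono[of s 1 "pi / 2"] mult_left_mono[of "\<bar>x - m\<bar>" "pi / 2" s]
      by linarith
    then have "\<bar>s * (x - m)\<bar> < pi / 2" using s by (simp add: abs_mult)
    then show ?thesis by (intro cos_gt_zero_pi) linarith+
  qed
  define w where "w x = - s * tan (s * (x - m))" for x
  let ?D = "\<lambda>x. 2 * g x * g' x * w x - (g x)\<^sup>2 * (s\<^sup>2 + (w x)\<^sup>2)"
  have "(?D has_integral ((g \<beta>)\<^sup>2 * w \<beta> - (g \<alpha>)\<^sup>2 * w \<alpha>)) {\<alpha>..\<beta>}"
  proof (rule fundamental_theorem_of_calculus[OF ab(1)])
    fix x assume x: "x \<in> {\<alpha>..\<beta>}"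
    have c: "cos (s * (x - m)) \<noteq> 0" using cos_pos[OF x] by simp
    have "inverse ((cos (s * (x - m)))\<^sup>2) = 1 + (tan (s * (x - m)))\<^sup>2"
      using c tan_sec[OF c] by (simp add: power_inverse)
    then have "(w has_real_derivative - (s\<^sup>2 + (w x)\<^sup>2)) (at x)"
      unfolding w_def using c
      by (auto intro!: derivative_eq_intros simp: algebra_simps power2_eq_square)
    then have "((\<lambda>x. (g x)\<^sup>2 * w x) has_real_derivative ?D x) (at x)"
      by (auto intro!: derivative_eq_intros der simp: algebra_simps)
    then show "((\<lambda>x. (g x)\<^sup>2 * w x) has_vector_derivative ?D x) (at x within {\<alpha>..\<beta>})"
      by (simp add: has_real_derivative_iff_has_vector_derivative has_vector_derivative_at_within)
  qed
  then have D: "(?D has_integral 0) {\<alpha>..\<beta>}" using zero by simp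
  have contg: "continuous_on S g" for S
    by (meson der DERIV_continuous_on has_field_derivative_at_within)
  have contg': "continuous_on S g'" for S using cont continuous_on_subset by blast
  have 1: "((\<lambda>x. (g x)\<^sup>2) has_integral integral {\<alpha>..\<beta>} (\<lambda>x. (g x)\<^sup>2)) {\<alpha>..\<beta>}"
    by (intro integrable_integral integrable_continuous_real continuous_intros contg)
  have 2: "((\<lambda>x. (g' x)\<^sup>2) has_integral integral {\<alpha>..\<beta>} (\<lambda>x. (g' x)\<^sup>2)) {\<alpha>..\<beta>}"
    by (intro integrable_integral integrable_continuous_real continuous_intros contg')
  have "((\<lambda>x. (g' x)\<^sup>2 - s\<^sup>2 * (g x)\<^sup>2 - ?D x) has_integral
      integral {\<alpha>..\<beta>} (\<lambda>x. (g' x)\<^sup>2) - s\<^sup>2 * integral {\<alpha>..\<beta>} (\<lambda>x. (g x)\<^sup>2) - 0) {\<alpha>..\<beta>}"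
    by (intro has_integral_diff has_integral_mult_right 1 2 D)
  moreover have "(g' x)\<^sup>2 - s\<^sup>2 * (g x)\<^sup>2 - ?D x = (g' x - g x * w x)\<^sup>2" for x
    by (simp add: power2_eq_square algebra_simps)
  ultimately have "((\<lambda>x. (g' x - g x * w x)\<^sup>2) has_integral
      integral {\<alpha>..\<beta>} (\<lambda>x. (g' x)\<^sup>2) - s\<^sup>2 * integral {\<alpha>..\<beta>} (\<lambda>x. (g x)\<^sup>2)) {\<alpha>..\<beta>}"
    by simp
  then have "0 \<le> integral {\<alpha>..\<beta>} (\<lambda>x. (g' x)\<^sup>2) - s\<^sup>2 * integral {\<alpha>..\<beta>} (\<lambda>x. (g x)\<^sup>2)"
    by (rule has_integral_nonneg) simp
  then show "z * integral {\<alpha>..\<beta>} (\<lambda>x. (g x)\<^sup>2) \<le> integral {\<alpha>..\<beta>} (\<lambda>x. (g' x)\<^sup>2)"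
    using s by simp
qed

text \<open>Three intervals between zeros suffice to cover a period: from a zero \<open>z0\<close>
  to the last zero \<open>z1\<close> within \<pi> after it, from there to the first zero
  \<open>z2\<close> in the second half period, and from \<open>z2\<close> to
  \<open>z0 + 2 * pi\<close>. The outer two have length at most \<pi> by construction, the middle
  one by the hypothesis on zeros.\<close>

lemma mixed_area_self_nonpos:
  assumes g: "C2_periodic g" and zeros: "\<And>\<alpha>. \<exists>z\<in>{\<alpha>..\<alpha> + pi}. g z = 0"
  shows "mixed_area g g \<le> 0"
proof -
  define F where "F x = (g x)\<^sup>2 - (deriv g x)\<^sup>2" for x
  obtain z0 where z0: "0 \<le> z0" "z0 \<le> pi" "g z0 = 0" using zeros[of 0] by auto
  define Z where "Z = {x. g x = 0}"
  have contF: "continuous_on S F" for S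
    unfolding F_def by (intro continuous_intros C2_periodic_continuous_intros g)
  have "closed Z"
    unfolding Z_def using C2_periodic_continuous[OF g, of UNIV]
    by (simp add: closed_Collect_eq)
  then have comp: "compact (Z \<inter> {a..b})" for a b
    by (simp add: closed_Int_compact)
  have "Z \<inter> {z0..z0 + pi} \<noteq> {}" using z0 by (auto simp: Z_def)
  then obtain z1 where z1: "z1 \<in> Z \<inter> {z0..z0 + pi}" "\<And>y. y \<in> Z \<inter> {z0..z0 + pi} \<Longrightarrow> y \<le> z1"
    using compact_attains_sup[OF comp] by metis
  have "z0 + 2 * pi \<in> Z" using z0 C2_periodic_shift[OF g] by (simp add: Z_def)
  then have "Z \<inter> {z0 + pi..z0 + 2 * pi} \<noteq> {}" by auto
  then obtain z2 where z2: "z2 \<in> Z \<inter> {z0 + pi..z0 + 2 * pi}"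
      "\<And>y. y \<in> Z \<inter> {z0 + pi..z0 + 2 * pi} \<Longrightarrow> z2 \<le> y"
    using compact_attains_inf[OF comp] by metis
  have gap: "z2 - z1 \<le> pi"
  proof (rule ccontr)
    assume *: "\<not> z2 - z1 \<le> pi"
    \<comment> \<open>The half circle centred at the midpoint of \<open>z1\<close> and
      \<open>z2\<close> lies strictly inside a gap longer than \<pi>, so its zero contradicts the
      choice of \<open>z1\<close> or \<open>z2\<close>.\<close>
    obtain z where z: "(z1 + z2 - pi) / 2 \<le> z" "z \<le> (z1 + z2 - pi) / 2 + pi" "z \<in> Z"
      using zeros[of "(z1 + z2 - pi) / 2"] by (auto simp: Z_def)
    have "z1 < z" "z < z2" using z * by (auto simp: field_simps)
    moreover have "z \<in> Z \<inter> {z0..z0 + pi} \<or> z \<in> Z \<inter> {z0 + pi..z0 + 2 * pi}"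
      using z \<open>z1 < z\<close> \<open>z < z2\<close> z1(1) z2(1) by auto
    ultimately show False using z1(2) z2(2) by force
  qed
  have piece: "integral {\<alpha>..\<beta>} F \<le> 0" if "\<alpha> \<le> \<beta>" "\<beta> - \<alpha> \<le> pi" "\<alpha> \<in> Z" "\<beta> \<in> Z" for \<alpha> \<beta>
  proof -
    have "integral {\<alpha>..\<beta>} F =
        integral {\<alpha>..\<beta>} (\<lambda>x. (g x)\<^sup>2) - integral {\<alpha>..\<beta>} (\<lambda>x. (deriv g x)\<^sup>2)"
      unfolding F_def by (intro integral_diff integrable_continuous_real continuous_intros
          C2_periodic_continuous_intros g)
    also have "\<dots> \<le> 0"
      using wirtinger_interval[OF C2_periodic_deriv[OF g] C2_periodic_continuous_deriv[OF g]] that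
      by (simp add: Z_def)
    finally show ?thesis .
  qed
  have intF: "F integrable_on {a..b}" for a b
    by (rule integrable_continuous_real[OF contF])
  have "integral {0..2 * pi} F = integral {z0..z0 + 2 * pi} F"
    by (rule periodic_integral[symmetric, OF contF])
      (use z0 in \<open>auto simp: F_def C2_periodic_shift[OF g] C2_periodic_shift_deriv[OF g]\<close>)
  also have "\<dots> = integral {z0..z1} F + integral {z1..z0 + 2 * pi} F"
    by (rule Henstock_Kurzweil_Integration.integral_combine[symmetric]) (use z1(1) intF in auto)
  also have "integral {z1..z0 + 2 * pi} F = integral {z1..z2} F + integral {z2..z0 + 2 * pi} F"
    by (rule Henstock_Kurzweil_Integration.integral_combine[symmetric]) (use z1(1) z2(1) intF in auto)
  also have "integral {z0..z1} F + (integral {z1..z2} F + integral {z2..z0 + 2 * pi} F) \<le> 0 + (0 + 0)"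
    by (intro add_mono piece) (use z0 z1(1) z2(1) gap \<open>z0 + 2 * pi \<in> Z\<close> in \<open>auto simp: Z_def\<close>)
  finally have "integral {0..2 * pi} F \<le> 0" by simp
  moreover have "(F has_integral 2 * mixed_area g g) {0..2 * pi}"
    using mixed_area_by_parts[OF g g] unfolding F_def by (simp add: power2_eq_square)
  ultimately show ?thesis by (simp add: has_integral_iff)
qed

section \<open>The Bonnesen-Blaschke inequality and its consequences\<close>

text \<open>The contact directions of K with r L, when \<open>a\<close> and \<open>b\<close> are the
  support functions: no open arc longer than \<pi> is free of them.\<close>

definition touching :: "(real \<Rightarrow> real) \<Rightarrow> (real \<Rightarrow> real) \<Rightarrow> real \<Rightarrow> bool" where
  "touching a b r \<longleftrightarrow> (\<forall>\<alpha>. \<exists>z\<in>{\<alpha>..\<alpha> + pi}. a z = r * b z)"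

definition regular_support :: "(real \<Rightarrow> real) \<Rightarrow> bool" where
  "regular_support f \<longleftrightarrow> C2_periodic f \<and> (\<forall>x. f x > 0) \<and> (\<forall>x. curv_radius f x > 0)"

text \<open>Integration against the cone-volume density \<open>a * curv_radius a / 2\<close>,
  written in the angle; \<open>integral_cone_volume_measure\<close> justifies this reading.\<close>

definition cone_integral :: "(real \<Rightarrow> real) \<Rightarrow> (real \<Rightarrow> real) \<Rightarrow> real" where
  "cone_integral a F = integral {0..2 * pi} (\<lambda>x. F x * (a x * curv_radius a x)) / 2"

lemma regular_supportD:
  assumes "regular_support f"
  shows "C2_periodic f" "f x > 0" "curv_radius f x > 0"
  using assms unfolding regular_support_def by auto

lemma has_integral_pos_cont:
  fixes F :: "real \<Rightarrow> real"
  assumes "(F has_integral I) {a..b}" "continuous_on {a..b} F" "a < b" "\<And>x. F x > 0"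
  shows "I > 0"
proof -
  have nonneg: "F x \<ge> 0" for x using assms(4)[of x] by simp
  have "I \<ge> 0" using has_integral_nonneg[OF assms(1)] nonneg by blast
  moreover have "integral {a..b} F \<noteq> 0"
    using integral_eq_0_iff[OF assms(2,3)] nonneg assms(3) assms(4)[of a] by force
  then have "I \<noteq> 0" using assms(1) by (simp add: has_integral_iff)
  ultimately show ?thesis by simp
qed

lemma mixed_area_pos:
  assumes f: "regular_support f" and g: "regular_support g"
  shows "mixed_area f g > 0"
proof -
  note F = regular_supportD[OF f] and G = regular_supportD[OF g]
  have "2 * mixed_area f g > 0"
  proof (rule has_integral_pos_cont[OF mixed_area_has_integral[OF F(1) G(1)]])
    show "continuous_on {0..2 * pi} (\<lambda>x. f x * curv_radius g x)"
      by (intro continuous_intros C2_periodic_continuous_intros F G)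
  qed (use F G in auto)
  then show ?thesis by simp
qed

lemma regular_support_lincomb:
  assumes f: "regular_support f" and g: "regular_support g" and "c \<ge> 0" "d \<ge> 0" "c + d > 0"
  shows "regular_support (\<lambda>x. c * f x + d * g x)"
proof -
  note F = regular_supportD[OF f] and G = regular_supportD[OF g]
  have *: "c * u + d * v > 0" if "u > 0" "v > 0" for u v :: real
  proof (cases "c = 0")
    case False
    then show ?thesis using that assms by (intro add_pos_nonneg) auto
  qed (use that assms in auto)
  show ?thesis
    unfolding regular_support_def C2_periodic_lincomb(2)[OF F(1) G(1)]
    using * F G C2_periodic_lincomb(1)[OF F(1) G(1)] by blast
qed

lemma cone_integral_has_integral:
  assumes "regular_support a" "continuous_on {0..2 * pi} F"
  shows "((\<lambda>x. F x * (a x * curv_radius a x)) has_integral 2 * cone_integral a F) {0..2 * pi}"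
proof -
  have "(\<lambda>x. F x * (a x * curv_radius a x)) integrable_on {0..2 * pi}"
    by (intro integrable_continuous_real continuous_intros C2_periodic_continuous_intros
        regular_supportD assms)
  then show ?thesis unfolding cone_integral_def by (simp add: integrable_integral)
qed

lemma cone_integral_const: "cone_integral a (\<lambda>x. c) = c * mixed_area a a"
  unfolding cone_integral_def mixed_area_def by simp

lemma cone_integral_cong:
  assumes "\<And>x. F x = G x" shows "cone_integral a F = cone_integral a G"
  by (rule arg_cong[of F G]) (use assms in blast)

context
  fixes a b :: "real \<Rightarrow> real" and r R :: real
  assumes a: "regular_support a" and b: "regular_support b"
    and lower: "\<And>x. r * b x \<le> a x" and upper: "\<And>x. a x \<le> R * b x"
    and touch: "touching a b r" "touching a b R"
begin

lemma bonnesen: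
  assumes "r \<le> t" "t \<le> R"
  shows "mixed_area a a - 2 * t * mixed_area a b + t\<^sup>2 * mixed_area b b \<le> 0"
proof -
  note A = regular_supportD(1)[OF a] and B = regular_supportD(1)[OF b]
  define q where "q t = mixed_area a a - 2 * t * mixed_area a b + t\<^sup>2 * mixed_area b b" for t
  have end_points: "q s \<le> 0" if "touching a b s" for s
  proof -
    have "mixed_area (\<lambda>x. 1 * a x + (- s) * b x) (\<lambda>x. 1 * a x + (- s) * b x) \<le> 0"
      by (rule mixed_area_self_nonpos[OF C2_periodic_lincomb(1)[OF A B]])
        (use that in \<open>auto simp: touching_def\<close>)
    then show ?thesis unfolding mixed_area_lincomb_self[OF A B] q_def by simp
  qed
  \<comment> \<open>A quadratic with leading coefficient A lies below its chord over [r, R] by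
    exactly A (t - r) (R - t). The identity is multiplied by R - r, hence the separate case R = r
    below.\<close>
  have "(R - r) * q t = (R - t) * q r + (t - r) * q R - mixed_area b b * ((t - r) * (R - t) * (R - r))"
    unfolding q_def by (simp add: power2_eq_square algebra_simps)
  also have "\<dots> \<le> 0"
  proof -
    have "(R - t) * q r \<le> 0" "(t - r) * q R \<le> 0"
      using end_points touch assms by (auto intro!: mult_nonneg_nonpos)
    moreover have "mixed_area b b * ((t - r) * (R - t) * (R - r)) \<ge> 0"
      using mixed_area_pos[OF b b] assms by (intro mult_nonneg_nonneg) auto
    ultimately show ?thesis by linarith
  qed
  finally have "(R - r) * q t \<le> 0" .
  then have "q t \<le> 0"
    using end_points[OF touch(1)] assms by (cases "R = r") (auto simp: mult_le_0_iff)
  then show ?thesis unfolding q_def .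
qed

lemma ratio_inequality:
  shows "mixed_area b b * cone_integral a (\<lambda>x. a x / b x) \<le> mixed_area a a * mixed_area a b"
    and "mixed_area b b * cone_integral a (\<lambda>x. a x / b x) = mixed_area a a * mixed_area a b \<Longrightarrow>
      \<exists>c>0. \<forall>x. a x = c * b x"
proof -
  note A = regular_supportD[OF a] and B = regular_supportD[OF b]
  define q where "q t = mixed_area a a - 2 * t * mixed_area a b + t\<^sup>2 * mixed_area b b" for t
  \<comment> \<open>The weight \<open>b * curv_radius a\<close> makes all three terms integrate to
    known quantities: the constant term to V(b, a), the linear one to V(a, a), and the quadratic
    one, since \<open>(a / b)\<^sup>2 * b = (a / b) * a\<close>, to the cone integral of
    \<open>a / b\<close>.\<close>
  define G where "G x = - q (a x / b x) * (b x * curv_radius a x)" for x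
  have b0: "b x \<noteq> 0" for x using B(2)[of x] by simp
  have "r \<le> a x / b x" "a x / b x \<le> R" for x
    using lower[of x] upper[of x] B(2)[of x] by (simp_all add: field_simps)
  then have q: "q (a x / b x) \<le> 0" for x
    unfolding q_def using bonnesen by blast
  then have G_nonneg: "G x \<ge> 0" for x
    unfolding G_def using A(3)[of x] B(2)[of x] by (intro mult_nonneg_nonneg) auto
  have cont_ratio: "continuous_on S (\<lambda>x. a x / b x)" for S
    by (intro continuous_intros C2_periodic_continuous_intros A B) (use b0 in auto)
  have contG: "continuous_on S G" for S
    unfolding G_def q_def
    by (intro continuous_intros C2_periodic_continuous_intros A B cont_ratio)
  have "((\<lambda>x. 2 * mixed_area a b * (a x * curv_radius a x)
        - mixed_area a a * (b x * curv_radius a x)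
        - mixed_area b b * (a x / b x * (a x * curv_radius a x)))
      has_integral 2 * mixed_area a b * (2 * mixed_area a a) - mixed_area a a * (2 * mixed_area b a)
        - mixed_area b b * (2 * cone_integral a (\<lambda>x. a x / b x))) {0..2 * pi}"
    by (intro has_integral_diff has_integral_mult_right mixed_area_has_integral A B
        cone_integral_has_integral a cont_ratio)
  moreover have "2 * mixed_area a b * (a x * curv_radius a x)
        - mixed_area a a * (b x * curv_radius a x)
        - mixed_area b b * (a x / b x * (a x * curv_radius a x)) = G x" for x
    unfolding G_def q_def using b0[of x] by (simp add: field_simps power2_eq_square)
  ultimately have G: "(G has_integral 2 * (mixed_area a a * mixed_area a b
      - mixed_area b b * cone_integral a (\<lambda>x. a x / b x))) {0..2 * pi}"
    by (simp add: mixed_area_commute[OF A(1) B(1)] algebra_simps)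
  from has_integral_nonneg[OF this] G_nonneg
  show "mixed_area b b * cone_integral a (\<lambda>x. a x / b x) \<le> mixed_area a a * mixed_area a b"
    by simp
  assume eq: "mixed_area b b * cone_integral a (\<lambda>x. a x / b x) = mixed_area a a * mixed_area a b"
  then have "integral {0..2 * pi} G = 0" using G by (simp add: has_integral_iff)
  then have "\<forall>x\<in>{0..2 * pi}. G x = 0"
    using integral_eq_0_iff[OF contG] G_nonneg by auto
  then have root: "q (a x / b x) = 0" if "x \<in> {0..2 * pi}" for x
    using that A(3)[of x] B(2)[of x] unfolding G_def by auto
  define p where "p = [:mixed_area a a, - 2 * mixed_area a b, mixed_area b b:]"
  have "p \<noteq> 0" using mixed_area_pos[OF b b] by (simp add: p_def)
  moreover have "q t = poly p t" for t
    by (simp add: q_def p_def power2_eq_square algebra_simps)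
  ultimately have "finite {t. q t = 0}" using poly_roots_finite[of p] by simp
  then have "finite ((\<lambda>x. a x / b x) ` {0..2 * pi})"
    by (rule finite_subset[rotated]) (use root in auto)
  from continuous_finite_range_constant[OF _ cont_ratio this]
  obtain c where c: "\<And>x. x \<in> {0..2 * pi} \<Longrightarrow> a x / b x = c"
    unfolding constant_on_def by (auto simp: is_interval_connected)
  have "a x / b x = c" for x
  proof -
    have "a (y + 2 * pi) / b (y + 2 * pi) = a y / b y" for y
      using C2_periodic_shift[OF A(1)] C2_periodic_shift[OF B(1)] by simp
    then obtain y where "0 \<le> y" "y < 0 + 2 * pi" "a y / b y = a x / b x"
      using periodic_range[of "\<lambda>x. a x / b x"] by metis
    then show ?thesis using c[of y] by simp
  qed
  moreover from this[of 0] A(2)[of 0] B(2)[of 0] have "c > 0" by (metis divide_pos_pos)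
  ultimately show "\<exists>c>0. \<forall>x. a x = c * b x"
    using b0 by (metis nonzero_mult_div_cancel_right times_divide_eq_left)
qed

end

lemma mixed_area_scale:
  assumes "C2_periodic b" "\<And>x. a x = c * b x"
  shows "mixed_area a a = c\<^sup>2 * mixed_area b b"
proof -
  have "a = (\<lambda>x. c * b x + 0 * b x)" using assms(2) by auto
  then show ?thesis using mixed_area_lincomb_self[OF assms(1,1), of c 0] by simp
qed

section \<open>Uniqueness and the two log-Minkowski inequalities for support functions\<close>

context
  fixes a b :: "real \<Rightarrow> real" and r R :: real
  assumes a: "regular_support a" and b: "regular_support b"
    and lower: "\<And>x. r * b x \<le> a x" and upper: "\<And>x. a x \<le> R * b x"
    and r: "r > 0" and touch: "touching a b r" "touching a b R"
begin

text \<open>Two test functions are enough to compare the measures. The constant 1 gives equal areas;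
  \<open>a / b\<close> integrated against the density of \<open>b\<close> gives V(a, b), which is
  the equality case of \<open>ratio_inequality\<close>. Equal areas then force the factor c to be
  1.\<close>

lemma cone_integral_determines:
  assumes mass: "cone_integral a (\<lambda>x. 1) = cone_integral b (\<lambda>x. 1)"
    and ratio: "cone_integral a (\<lambda>x. a x / b x) = cone_integral b (\<lambda>x. a x / b x)"
  shows "a x = b x"
proof -
  note A = regular_supportD[OF a] and B = regular_supportD[OF b]
  have V: "mixed_area a a = mixed_area b b" using mass by (simp add: cone_integral_const)
  have "a x / b x * (b x * curv_radius b x) = a x * curv_radius b x" for x
    using B(2)[of x] by simp
  then have "cone_integral b (\<lambda>x. a x / b x) = mixed_area a b"
    unfolding cone_integral_def mixed_area_def by simp
  then obtain c where c: "c > 0" "\<And>x. a x = c * b x"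
    using ratio_inequality(2)[OF a b lower upper touch] V ratio by auto
  then have "c\<^sup>2 = 1"
    using mixed_area_scale[of b a c] B(1) V mixed_area_pos[OF b b] by auto
  then have "c = 1" using c(1) by (simp add: power2_eq_1_iff)
  then show ?thesis using c(2) by simp
qed

text \<open>Where \<open>a = s * b\<close>, the interpolated function equals \<open>k * a\<close>;
  this is the origin of k. More precisely, \<open>a\<close> minus 1 / k times the interpolation is
  \<open>t / (s * k)\<close> times \<open>a - s * b\<close>, so zeros and signs are inherited, and
  \<open>ratio_inequality\<close> applies to \<open>a\<close> and the interpolation with 1 / k in
  place of s.\<close>

lemma interpolation_touching:
  assumes t: "0 < t" "t \<le> 1" and s: "s > 0" "touching a b s"
  defines "k \<equiv> (1 - t) + t / s"
  shows "k > 0" "touching a (\<lambda>x. (1 - t) * a x + t * b x) (1 / k)"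
    "\<And>x. s * b x \<le> a x \<Longrightarrow> 1 / k * ((1 - t) * a x + t * b x) \<le> a x"
    "\<And>x. a x \<le> s * b x \<Longrightarrow> a x \<le> 1 / k * ((1 - t) * a x + t * b x)"
proof -
  show k: "k > 0" unfolding k_def using t s by (intro add_nonneg_pos) auto
  have key: "a x - 1 / k * ((1 - t) * a x + t * b x) = t / (s * k) * (a x - s * b x)" for x
  proof -
    have "s * k = s * (1 - t) + t" using s by (simp add: k_def field_simps)
    then have "s * k * a x - s * ((1 - t) * a x + t * b x) = t * (a x - s * b x)"
      by (simp only:) (simp add: algebra_simps)
    moreover have "a x - 1 / k * ((1 - t) * a x + t * b x)
        = (s * k * a x - s * ((1 - t) * a x + t * b x)) / (s * k)"
      using k s by (simp add: field_simps)
    ultimately show ?thesis by simp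
  qed
  have c: "t / (s * k) > 0" using t s k by simp
  show "touching a (\<lambda>x. (1 - t) * a x + t * b x) (1 / k)"
    unfolding touching_def
  proof
    fix \<alpha> obtain z where "z \<in> {\<alpha>..\<alpha> + pi}" "a z = s * b z" using s(2) unfolding touching_def by blast
    with key[of z] show "\<exists>z\<in>{\<alpha>..\<alpha> + pi}. a z = 1 / k * ((1 - t) * a z + t * b z)"
      by (intro bexI[of _ z]) auto
  qed
  show "1 / k * ((1 - t) * a x + t * b x) \<le> a x" if "s * b x \<le> a x" for x
    using key[of x] mult_nonneg_nonneg[of "t / (s * k)" "a x - s * b x"] c that by linarith
  show "a x \<le> 1 / k * ((1 - t) * a x + t * b x)" if "a x \<le> s * b x" for x
    using key[of x] mult_nonneg_nonpos[of "t / (s * k)" "a x - s * b x"] c that by linarith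
qed

text \<open>
  The difference of both sides is monotone along \<open>b\<^sub>t = (1 - t) a + t b\<close>, because its
  derivative in \<open>t\<close> is the defect of the ratio inequality for the pair \<open>(a, b\<^sub>t)\<close>.
\<close>

lemma log_minkowski_aux:
  assumes not_prop: "\<not> (\<exists>c>0. \<forall>x. a x = c * b x)"
  shows "mixed_area a a / 2 * ln (mixed_area b b / mixed_area a a) < cone_integral a (\<lambda>x. ln (b x / a x))"
proof -
  note A = regular_supportD[OF a] and B = regular_supportD[OF b]
  define bt where "bt t x = (1 - t) * a x + t * b x" for t x
  define P where "P t = (1 - t)\<^sup>2 * mixed_area a a + 2 * (1 - t) * t * mixed_area a b + t\<^sup>2 * mixed_area b b" for t
  define P' where "P' t = - 2 * (1 - t) * mixed_area a a + 2 * (1 - 2 * t) * mixed_area a b + 2 * t * mixed_area b b" for t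
  have reg: "regular_support (bt t)" if "0 \<le> t" "t \<le> 1" for t
    unfolding bt_def using that by (intro regular_support_lincomb a b) auto
  have P: "mixed_area (bt t) (bt t) = P t" for t
    unfolding bt_def P_def by (rule mixed_area_lincomb_self[OF A(1) B(1)])
  have P_pos: "P t > 0" if "0 \<le> t" "t \<le> 1" for t
    using mixed_area_pos[OF reg reg] that P by metis
  define w where "w x = a x * curv_radius a x" for x
  define J where "J t = integral {0..2 * pi} (\<lambda>x. ln (bt t x / a x) * w x) / 2" for t
  define J' where "J' t = integral {0..2 * pi} (\<lambda>x. (b x - a x) / bt t x * w x) / 2" for t
  define \<Phi> where "\<Phi> t = J t - mixed_area a a / 2 * ln (P t / mixed_area a a)" for t
  have Va: "mixed_area a a > 0" by (rule mixed_area_pos[OF a a])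
  have contw: "continuous_on S w" for S
    unfolding w_def by (intro continuous_intros C2_periodic_continuous_intros A)
  have bt_pos: "bt t x > 0" if "0 \<le> t" "t \<le> 1" for t x
    using regular_supportD(2)[OF reg[OF that]] .
  have a0: "a x \<noteq> 0" for x using A(2)[of x] by simp
  have contbt: "continuous_on S (bt t)" for S t
    unfolding bt_def by (intro continuous_intros C2_periodic_continuous_intros A B)
  have J: "(J has_real_derivative J' t) (at t within {0..1})" if t: "t \<in> {0..1}" for t
  proof -
    have "((\<lambda>t. integral (cbox 0 (2 * pi)) (\<lambda>x. ln (bt t x / a x) * w x))
        has_real_derivative integral (cbox 0 (2 * pi)) (\<lambda>x. (b x - a x) / bt t x * w x))
       (at t within {0..1})"
    proof (rule leibniz_rule_field_derivative)
      fix s x :: real assume s: "s \<in> {0..1}"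
      show "((\<lambda>s. ln (bt s x / a x) * w x) has_real_derivative (b x - a x) / bt s x * w x)
          (at s within {0..1})"
      proof -
        have "((\<lambda>s. bt s x / a x) has_real_derivative (b x - a x) / a x) (at s within {0..1})"
          unfolding bt_def by (rule DERIV_cdivide) (auto intro!: derivative_eq_intros)
        moreover have "bt s x / a x > 0" using bt_pos[of s x] A(2)[of x] s by simp
        ultimately have "((\<lambda>s. ln (bt s x / a x)) has_real_derivative
            1 / (bt s x / a x) * ((b x - a x) / a x)) (at s within {0..1})"
          by (rule DERIV_chain2[OF DERIV_ln_divide, rotated])
        from DERIV_cmult_right[OF this, of "w x"] show ?thesis using a0[of x] by simp
      qed
      have "continuous_on {0..2 * pi} (\<lambda>x. ln (bt s x / a x) * w x)"
        by (intro continuous_intros contbt C2_periodic_continuous_intros A contw)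
          (use bt_pos[of s] a0 s in \<open>auto simp: less_imp_neq[symmetric]\<close>)
      then show "(\<lambda>x. ln (bt s x / a x) * w x) integrable_on cbox 0 (2 * pi)"
        by (simp add: integrable_continuous_real)
    next
      have 1: "continuous_on S (\<lambda>p. f (snd p))" if "continuous_on UNIV f"
        for f :: "real \<Rightarrow> real" and S :: "(real \<times> real) set"
        by (rule continuous_on_compose2[OF that]) (auto intro!: continuous_intros)
      show "continuous_on ({0..1} \<times> cbox 0 (2 * pi)) (\<lambda>(s, x). (b x - a x) / bt s x * w x)"
        unfolding split_beta bt_def
        by (intro continuous_intros 1 contw C2_periodic_continuous_intros A B)
          (use bt_pos in \<open>force simp: bt_def less_imp_neq[symmetric]\<close>)
    qed (use t in auto)
    from DERIV_cdivide[OF this, of 2] show ?thesis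
      unfolding J_def[abs_def] J'_def by simp
  qed
  have \<Phi>: "(\<Phi> has_real_derivative J' t - mixed_area a a / 2 * (P' t / P t)) (at t within {0..1})"
    if t: "t \<in> {0..1}" for t
  proof -
    have dP: "(P has_real_derivative P' t) (at t within {0..1})"
      unfolding P_def[abs_def] P'_def
      by (auto intro!: derivative_eq_intros simp: power2_eq_square algebra_simps)
    show ?thesis
      unfolding \<Phi>_def[abs_def] using P_pos[of t] t Va
      by (auto intro!: derivative_eq_intros J dP)
  qed
  have pos: "J' t - mixed_area a a / 2 * (P' t / P t) > 0" if t: "0 < t" "t < 1" for t
  proof -
    have "0 < R * b 0" using upper[of 0] A(2)[of 0] by linarith
    then have R: "R > 0" using B(2)[of 0] by (rule zero_less_mult_pos2)
    have t': "0 \<le> t" "t \<le> 1" using t by auto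
    have k: "(1 - t) + t / r > 0" "(1 - t) + t / R > 0"
      using interpolation_touching(1) t' t r R touch by auto
    note ratio = ratio_inequality[OF a reg[OF t'],
        of "1 / ((1 - t) + t / r)" "1 / ((1 - t) + t / R)", unfolded bt_def,
        OF interpolation_touching(3)[OF t(1) t'(2) r touch(1) lower]
          interpolation_touching(4)[OF t(1) t'(2) R touch(2) upper]
          interpolation_touching(2)[OF t(1) t'(2) r touch(1)]
          interpolation_touching(2)[OF t(1) t'(2) R touch(2)], folded bt_def]
    define I where "I = cone_integral a (\<lambda>x. a x / bt t x)"
    have Vabt: "mixed_area a (bt t) = (1 - t) * mixed_area a a + t * mixed_area a b"
      unfolding bt_def by (rule mixed_area_lincomb_right[OF A(1) B(1) A(1)])
    \<comment> \<open>Since t > 0, proportionality of \<open>a\<close> to \<open>bt t\<close> could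
      be solved for proportionality to \<open>b\<close>. Excluding it makes the ratio inequality
      strict.\<close>
    have "\<not> (\<exists>c>0. \<forall>x. a x = c * bt t x)"
    proof
      assume "\<exists>c>0. \<forall>x. a x = c * bt t x"
      then obtain c where c: "c > 0" "\<And>x. a x = c * bt t x" by blast
      define d where "d = 1 - c * (1 - t)"
      have d: "d * a x = c * t * b x" for x
        using c(2)[of x] by (simp add: d_def bt_def algebra_simps)
      have "d * a 0 > 0" unfolding d using c(1) t B(2) by simp
      then have "d > 0" using A(2)[of 0] by (simp add: zero_less_mult_iff)
      then have "\<forall>x. a x = c * t / d * b x" using d by (simp add: field_simps)
      moreover have "c * t / d > 0" using \<open>d > 0\<close> c(1) t by simp
      ultimately show False using not_prop by blast
    qed
    then have "mixed_area (bt t) (bt t) * I \<noteq> mixed_area a a * mixed_area a (bt t)"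
      using ratio(2) unfolding I_def by blast
    moreover have "mixed_area (bt t) (bt t) * I \<le> mixed_area a a * mixed_area a (bt t)"
      using ratio(1) unfolding I_def by blast
    ultimately have less: "P t * I < mixed_area a a * ((1 - t) * mixed_area a a + t * mixed_area a b)"
      unfolding P Vabt by simp
    have cont: "continuous_on {0..2 * pi} (\<lambda>x. (b x - a x) / bt t x)"
        "continuous_on {0..2 * pi} (\<lambda>x. a x / bt t x)"
      by (intro continuous_intros contbt C2_periodic_continuous_intros A B;
          use bt_pos[OF t'] in \<open>auto simp: less_imp_neq[symmetric]\<close>)+
    have "((\<lambda>x. 1 * (a x * curv_radius a x) - t * ((b x - a x) / bt t x * (a x * curv_radius a x)))
        has_integral 2 * cone_integral a (\<lambda>x. 1) - t * (2 * cone_integral a (\<lambda>x. (b x - a x) / bt t x)))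
        {0..2 * pi}"
      by (intro has_integral_diff has_integral_mult_right cone_integral_has_integral a cont
          continuous_intros)
    \<comment> \<open>Because t (b - a) = \<open>bt t\<close> - a, multiplying the derivative
      \<open>J'\<close> by t produces the cone integral of \<open>a / bt t\<close>.\<close>
    moreover have "1 * (a x * curv_radius a x) - t * ((b x - a x) / bt t x * (a x * curv_radius a x))
        = a x / bt t x * (a x * curv_radius a x)" for x
    proof -
      have "bt t x - t * (b x - a x) = a x" by (simp add: bt_def algebra_simps)
      then have "1 - t * ((b x - a x) / bt t x) = a x / bt t x"
        using bt_pos[OF t', of x] by (simp add: field_simps)
      moreover have "1 * u - t * (q * u) = (1 - t * q) * u" for q u :: real
        by (simp add: algebra_simps)
      ultimately show ?thesis by metis
    qed
    ultimately have "2 * I = 2 * mixed_area a a - t * (2 * J' t)"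
      using cone_integral_has_integral[OF a cont(2)]
      by (simp add: I_def cone_integral_const has_integral_iff J'_def w_def cone_integral_def)
    then have tJ: "t * J' t = mixed_area a a - I" by simp
    \<comment> \<open>The same relation for the area: \<open>P'\<close> is 2 V(b_t, b - a), so t
      \<open>P'\<close> / 2 is V(b_t, b_t - a), where b_t stands for \<open>bt t\<close>.\<close>
    have tP: "t * P' t / 2 = P t - ((1 - t) * mixed_area a a + t * mixed_area a b)"
      unfolding P_def P'_def by (simp add: power2_eq_square field_simps)
    have "t * (J' t - mixed_area a a / 2 * (P' t / P t))
        = mixed_area a a - I - mixed_area a a * (t * P' t / 2) / P t"
      using tJ by (simp add: algebra_simps)
    also have "\<dots> = (mixed_area a a * ((1 - t) * mixed_area a a + t * mixed_area a b) - P t * I) / P t"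
      unfolding tP using P_pos[OF t'] by (simp add: field_simps)
    also have "\<dots> > 0" using less P_pos[OF t'] by simp
    finally show ?thesis using t by (simp add: zero_less_mult_iff)
  qed
  \<comment> \<open>The derivative vanishes at t = 0, where the interpolation is \<open>a\<close>
    itself, so strict monotonicity is drawn from the open interval together with continuity.\<close>
  have "\<Phi> 0 < \<Phi> 1"
  proof (rule DERIV_pos_imp_increasing_open[of 0 1 \<Phi>])
    show "continuous_on {0..1} \<Phi>" by (rule DERIV_continuous_on[OF \<Phi>])
    fix t :: real assume "0 < t" "t < 1"
    then show "\<exists>y. (\<Phi> has_real_derivative y) (at t) \<and> y > 0"
      using \<Phi>[of t] pos[of t] at_within_Icc_at[of 0 t 1]
      by (intro exI[of _ "J' t - mixed_area a a / 2 * (P' t / P t)"]) simp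
  qed simp
  moreover have "\<Phi> 0 = 0"
    unfolding \<Phi>_def J_def P_def bt_def using Va a0 by (simp add: a0)
  moreover have "\<Phi> 1 = cone_integral a (\<lambda>x. ln (b x / a x))
      - mixed_area a a / 2 * ln (mixed_area b b / mixed_area a a)"
    unfolding \<Phi>_def J_def P_def bt_def cone_integral_def w_def by simp
  ultimately show ?thesis by simp
qed

text \<open>The strict inequality for non-proportional functions leaves only a = c b, where both
  sides equal - V(a, a) ln c.\<close>

lemma log_minkowski:
  shows "mixed_area a a / 2 * ln (mixed_area b b / mixed_area a a) \<le> cone_integral a (\<lambda>x. ln (b x / a x))"
    and "cone_integral a (\<lambda>x. ln (b x / a x)) = mixed_area a a / 2 * ln (mixed_area b b / mixed_area a a)
      \<longleftrightarrow> (\<exists>c>0. \<forall>x. a x = c * b x)"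
proof -
  note A = regular_supportD[OF a] and B = regular_supportD[OF b]
  have eq: "cone_integral a (\<lambda>x. ln (b x / a x)) = mixed_area a a / 2 * ln (mixed_area b b / mixed_area a a)"
    if dil: "\<exists>c>0. \<forall>x. a x = c * b x"
  proof -
    obtain c where c: "c > 0" "\<And>x. a x = c * b x" using dil by blast
    have "cone_integral a (\<lambda>x. ln (b x / a x)) = cone_integral a (\<lambda>x. - ln c)"
    proof (rule cone_integral_cong)
      fix x show "ln (b x / a x) = - ln c"
        using c(1) B(2)[of x] unfolding c(2) by (simp add: ln_div)
    qed
    moreover have "mixed_area b b / mixed_area a a = 1 / c\<^sup>2"
      using mixed_area_scale[of b a c, OF B(1) c(2)] mixed_area_pos[OF b b] by simp
    moreover have "ln (1 / c\<^sup>2) = - 2 * ln c" using c(1) by (simp add: ln_div ln_realpow)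
    ultimately show ?thesis by (simp add: cone_integral_const)
  qed
  show "mixed_area a a / 2 * ln (mixed_area b b / mixed_area a a) \<le> cone_integral a (\<lambda>x. ln (b x / a x))"
    using eq log_minkowski_aux by (cases "\<exists>c>0. \<forall>x. a x = c * b x") simp_all
  show "cone_integral a (\<lambda>x. ln (b x / a x)) = mixed_area a a / 2 * ln (mixed_area b b / mixed_area a a)
      \<longleftrightarrow> (\<exists>c>0. \<forall>x. a x = c * b x)"
    using eq log_minkowski_aux by (cases "\<exists>c>0. \<forall>x. a x = c * b x") simp_all
qed

text \<open>Jensen's inequality in tangent line form: ln y <= y / m - 1 + ln m, integrated against
  the cone-volume density of \<open>a\<close>. With y the quotient of the two cone-volume densities,
  ln y splits into the two logarithms in question, and m = V(b, b) / V(a, a) is the mean of y, so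
  that the linear terms cancel.\<close>

lemma entropy_upper_bound:
  "cone_integral a (\<lambda>x. ln (curv_radius b x / curv_radius a x))
    \<le> mixed_area a a * ln (mixed_area b b / mixed_area a a) - cone_integral a (\<lambda>x. ln (b x / a x))"
proof -
  note A = regular_supportD[OF a] and B = regular_supportD[OF b]
  define m where "m = mixed_area b b / mixed_area a a"
  have m: "m > 0" unfolding m_def using mixed_area_pos a b by simp
  have nz: "a x \<noteq> 0" "b x \<noteq> 0" "curv_radius a x \<noteq> 0" "curv_radius b x \<noteq> 0" for x
    using A(2,3)[of x] B(2,3)[of x] by auto
  have cont: "continuous_on S (\<lambda>x. ln (curv_radius b x / curv_radius a x))"
      "continuous_on S (\<lambda>x. ln (b x / a x))" for S
    by (intro continuous_intros C2_periodic_continuous_intros A B; use nz in auto)+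
  have "2 * cone_integral a (\<lambda>x. ln (curv_radius b x / curv_radius a x))
      + 2 * cone_integral a (\<lambda>x. ln (b x / a x))
    \<le> 1 / m * (2 * mixed_area b b) + (ln m - 1) * (2 * mixed_area a a)"
  proof (rule has_integral_le)
    show "((\<lambda>x. ln (curv_radius b x / curv_radius a x) * (a x * curv_radius a x)
        + ln (b x / a x) * (a x * curv_radius a x)) has_integral
        2 * cone_integral a (\<lambda>x. ln (curv_radius b x / curv_radius a x))
        + 2 * cone_integral a (\<lambda>x. ln (b x / a x))) {0..2 * pi}"
      by (intro has_integral_add cone_integral_has_integral a cont)
    show "((\<lambda>x. 1 / m * (b x * curv_radius b x) + (ln m - 1) * (a x * curv_radius a x)) has_integral
        1 / m * (2 * mixed_area b b) + (ln m - 1) * (2 * mixed_area a a)) {0..2 * pi}"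
      by (intro has_integral_add has_integral_mult_right mixed_area_has_integral A B)
    fix x :: real
    define y where "y = b x * curv_radius b x / (a x * curv_radius a x)"
    have y: "y > 0" unfolding y_def using A B by simp
    have "ln y = ln (y / m) + ln m" using y m by (simp add: ln_div)
    also have "\<dots> \<le> y / m - 1 + ln m" using ln_le_minus_one[of "y / m"] y m by simp
    finally have "ln y * (a x * curv_radius a x) \<le> (y / m - 1 + ln m) * (a x * curv_radius a x)"
      using A(2,3)[of x] by (intro mult_right_mono) auto
    also have "\<dots> = 1 / m * (y * (a x * curv_radius a x)) + (ln m - 1) * (a x * curv_radius a x)"
      by (simp add: field_simps)
    also have "y * (a x * curv_radius a x) = b x * curv_radius b x"
      unfolding y_def using nz by simp
    also have "ln y = ln (curv_radius b x / curv_radius a x) + ln (b x / a x)"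
      unfolding y_def using A(2,3)[of x] B(2,3)[of x] by (simp add: ln_div ln_mult)
    finally show "ln (curv_radius b x / curv_radius a x) * (a x * curv_radius a x)
        + ln (b x / a x) * (a x * curv_radius a x)
      \<le> 1 / m * (b x * curv_radius b x) + (ln m - 1) * (a x * curv_radius a x)"
      by (simp add: distrib_right)
  qed
  moreover have "1 / m * (2 * mixed_area b b) = 2 * mixed_area a a"
    unfolding m_def using mixed_area_pos[OF b b] by simp
  ultimately show ?thesis unfolding m_def[symmetric] by (simp add: algebra_simps)
qed

text \<open>Subtracting the lower bound of \<open>log_minkowski\<close> leaves half of V(a, a) ln m
  from \<open>entropy_upper_bound\<close>, m being the quotient of areas. Equality here squeezes
  \<open>log_minkowski\<close> into its equality case.\<close>

lemma log_minkowski_entropy: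
  shows "cone_integral a (\<lambda>x. ln (curv_radius b x / curv_radius a x))
      \<le> mixed_area a a / 2 * ln (mixed_area b b / mixed_area a a)"
    and "cone_integral a (\<lambda>x. ln (curv_radius b x / curv_radius a x))
        = mixed_area a a / 2 * ln (mixed_area b b / mixed_area a a) \<Longrightarrow> \<exists>c>0. \<forall>x. a x = c * b x"
  using entropy_upper_bound log_minkowski by (simp_all add: field_simps)

end

text \<open>The hypotheses speak of radii of curvature and areas rather than of a = c b, because
  these are the quantities that survive a translation; this is what makes homothets, and not just
  dilates, equality cases.\<close>

lemma entropy_eqI:
  assumes a: "regular_support a" and b: "regular_support b" and c: "c > 0"
    and rad: "\<And>x. curv_radius a x = c * curv_radius b x"
    and area: "mixed_area a a = c\<^sup>2 * mixed_area b b"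
  shows "cone_integral a (\<lambda>x. ln (curv_radius b x / curv_radius a x))
      = mixed_area a a / 2 * ln (mixed_area b b / mixed_area a a)"
proof -
  note B = regular_supportD[OF b]
  have "cone_integral a (\<lambda>x. ln (curv_radius b x / curv_radius a x)) = cone_integral a (\<lambda>x. - ln c)"
  proof (rule cone_integral_cong)
    fix x show "ln (curv_radius b x / curv_radius a x) = - ln c"
      using c B(3)[of x] by (simp add: rad ln_div)
  qed
  moreover have "mixed_area b b / mixed_area a a = 1 / c\<^sup>2"
    using area mixed_area_pos[OF b b] by simp
  moreover have "ln (1 / c\<^sup>2) = - 2 * ln c" using c by (simp add: ln_div ln_realpow)
  ultimately show ?thesis by (simp add: cone_integral_const)
qed

section \<open>Support functions of planar convex bodies\<close>

lemma unit_vec_nth [simp]: "unit_vec \<theta> $ 1 = cos \<theta>" "unit_vec \<theta> $ 2 = sin \<theta>"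
  by (simp_all add: unit_vec_def)

lemma inner_unit_vec: "unit_vec \<theta> \<bullet> x = cos \<theta> * x $ 1 + sin \<theta> * x $ 2"
  by (simp add: inner_vec_def sum_2)

lemma norm_unit_vec [simp]: "norm (unit_vec \<theta>) = 1"
  by (simp add: norm_eq_1 inner_unit_vec power2_eq_square[symmetric])

lemma unit_vec_periodic [simp]: "unit_vec (\<theta> + 2 * pi) = unit_vec \<theta>"
  by (simp add: vec_eq_iff forall_2)

lemma unit_vec_eq_iff: "unit_vec \<theta> = unit_vec \<phi> \<longleftrightarrow> (\<exists>k. \<theta> = \<phi> + 2 * pi * of_int k)"
proof -
  have "unit_vec \<theta> = unit_vec \<phi> \<longleftrightarrow> sin \<theta> = sin \<phi> \<and> cos \<theta> = cos \<phi>"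
    by (auto simp: vec_eq_iff forall_2)
  then show ?thesis by (simp add: sin_cos_eq_iff)
qed

lemma norm_vec2: "(norm (x :: real^2))\<^sup>2 = (x $ 1)\<^sup>2 + (x $ 2)\<^sup>2"
  unfolding power2_norm_eq_inner by (simp add: inner_vec_def sum_2 power2_eq_square)

lemma normalized_vec2:
  fixes x :: "real^2"
  assumes "x \<noteq> 0"
  shows "(x $ 1 / norm x)\<^sup>2 + (x $ 2 / norm x)\<^sup>2 = 1"
proof -
  have "(x $ 1 / norm x)\<^sup>2 + (x $ 2 / norm x)\<^sup>2 = (norm x)\<^sup>2 / (norm x)\<^sup>2"
    unfolding norm_vec2 by (simp only: power_divide add_divide_distrib norm_vec2)
  also have "\<dots> = 1" using assms by (intro divide_self) simp
  finally show ?thesis .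
qed

lemma polar_decomposition:
  fixes x :: "real^2"
  obtains \<theta> where "x = norm x *\<^sub>R unit_vec \<theta>"
proof (cases "x = 0")
  case False
  then have n: "norm x > 0" by simp
  from False have "(x $ 1 / norm x)\<^sup>2 + (x $ 2 / norm x)\<^sup>2 = 1" by (rule normalized_vec2)
  then obtain \<theta> where "x $ 1 / norm x = cos \<theta>" "x $ 2 / norm x = sin \<theta>"
    by (rule sincos_total_2pi)
  then have \<theta>: "cos \<theta> = x $ 1 / norm x" "sin \<theta> = x $ 2 / norm x" by simp_all
  show ?thesis
    by (rule that[of \<theta>]) (use n in \<open>simp add: vec_eq_iff forall_2 \<theta>\<close>)
qed (use that[of 0] in simp)

context
  fixes K :: "(real^2) set" assumes K: "compact K" "K \<noteq> {}"
begin

lemma support_fun_upper: "y \<in> K \<Longrightarrow> x \<bullet> y \<le> support_fun K x"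
  unfolding support_fun_def using K(1)
  by (intro cSUP_upper bounded_imp_bdd_above compact_imp_bounded compact_continuous_image
      continuous_intros)

lemma support_fun_attained: obtains y where "y \<in> K" "x \<bullet> y = support_fun K x"
proof -
  have "continuous_on K (\<lambda>y. x \<bullet> y)" by (intro continuous_intros)
  from continuous_attains_sup[OF K this] obtain y
    where y: "y \<in> K" "\<And>z. z \<in> K \<Longrightarrow> x \<bullet> z \<le> x \<bullet> y" by blast
  have "support_fun K x = x \<bullet> y"
    unfolding support_fun_def by (rule cSup_eq_maximum) (use y in auto)
  then show ?thesis using that y by simp
qed

lemma support_angle_upper: "y \<in> K \<Longrightarrow> unit_vec \<theta> \<bullet> y \<le> support_angle K \<theta>"
  unfolding support_angle_def by (rule support_fun_upper)

lemma support_angle_attained: obtains y where "y \<in> K" "unit_vec \<theta> \<bullet> y = support_angle K \<theta>"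
  unfolding support_angle_def by (rule support_fun_attained)

lemma support_angle_leI:
  assumes "\<And>y. y \<in> K \<Longrightarrow> unit_vec \<theta> \<bullet> y \<le> m"
  shows "support_angle K \<theta> \<le> m"
  using assms support_angle_attained by metis

lemma mem_iff_support_angle:
  assumes "convex K"
  shows "x \<in> K \<longleftrightarrow> (\<forall>\<theta>. unit_vec \<theta> \<bullet> x \<le> support_angle K \<theta>)"
proof
  assume *: "\<forall>\<theta>. unit_vec \<theta> \<bullet> x \<le> support_angle K \<theta>"
  show "x \<in> K"
  proof (rule ccontr)
    assume "x \<notin> K"
    then obtain a b where ab: "a \<bullet> x < b" "\<And>y. y \<in> K \<Longrightarrow> a \<bullet> y > b"
      using separating_hyperplane_closed_point[OF assms compact_imp_closed[OF K(1)]] by blast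
    \<comment> \<open>The separating functional is larger on K than at x, so the outer direction is
      that of - a.\<close>
    obtain \<theta> where \<theta>: "- a = norm (- a) *\<^sub>R unit_vec \<theta>" using polar_decomposition by blast
    obtain y where y: "y \<in> K" "unit_vec \<theta> \<bullet> y = support_angle K \<theta>"
      by (rule support_angle_attained)
    have "norm (- a) * (unit_vec \<theta> \<bullet> x) \<le> norm (- a) * (unit_vec \<theta> \<bullet> y)"
      unfolding y(2) using * by (intro mult_left_mono) auto
    then have "(- a) \<bullet> x \<le> (- a) \<bullet> y" by (subst (1 2) \<theta>) simp
    then show False using ab(1) ab(2)[OF y(1)] by simp
  qed
qed (use support_angle_upper in blast)

end

lemma support_angle_periodic: "support_angle K (\<theta> + 2 * pi) = support_angle K \<theta>"
  by (simp add: support_angle_def)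

lemma convex_bodyD:
  assumes "convex_body K"
  shows "compact K" "convex K" "K \<noteq> {}"
  using assms interior_subset[of K] unfolding convex_body_def by auto

lemma subset_iff_support_angle:
  assumes K: "convex_body K" and L: "convex_body L" and t: "t > 0"
  shows "(\<lambda>y. x + t *\<^sub>R y) ` L \<subseteq> K \<longleftrightarrow>
      (\<forall>\<theta>. unit_vec \<theta> \<bullet> x + t * support_angle L \<theta> \<le> support_angle K \<theta>)"
proof
  note K = convex_bodyD[OF K] and L = convex_bodyD[OF L]
  assume *: "(\<lambda>y. x + t *\<^sub>R y) ` L \<subseteq> K"
  show "\<forall>\<theta>. unit_vec \<theta> \<bullet> x + t * support_angle L \<theta> \<le> support_angle K \<theta>"
  proof
    fix \<theta>
    obtain y where "y \<in> L" "unit_vec \<theta> \<bullet> y = support_angle L \<theta>"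
      using support_angle_attained L by metis
    then show "unit_vec \<theta> \<bullet> x + t * support_angle L \<theta> \<le> support_angle K \<theta>"
      using * support_angle_upper[OF K(1,3), of "x + t *\<^sub>R y" \<theta>] by (auto simp: inner_add_right)
  qed
next
  note K = convex_bodyD[OF K] and L = convex_bodyD[OF L]
  assume *: "\<forall>\<theta>. unit_vec \<theta> \<bullet> x + t * support_angle L \<theta> \<le> support_angle K \<theta>"
  have "x + t *\<^sub>R y \<in> K" if "y \<in> L" for y
    unfolding mem_iff_support_angle[OF K(1,3,2)]
  proof
    fix \<theta>
    have "t * (unit_vec \<theta> \<bullet> y) \<le> t * support_angle L \<theta>"
      using support_angle_upper[OF L(1,3) that] t by (intro mult_left_mono) auto
    then show "unit_vec \<theta> \<bullet> (x + t *\<^sub>R y) \<le> support_angle K \<theta>"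
      using *[rule_format, of \<theta>] by (simp add: inner_add_right)
  qed
  then show "(\<lambda>y. x + t *\<^sub>R y) ` L \<subseteq> K" by auto
qed

lemma supset_iff_support_angle:
  assumes K: "convex_body K" and L: "convex_body L" and t: "t > 0"
  shows "K \<subseteq> (\<lambda>y. x + t *\<^sub>R y) ` L \<longleftrightarrow>
      (\<forall>\<theta>. support_angle K \<theta> \<le> unit_vec \<theta> \<bullet> x + t * support_angle L \<theta>)"
proof -
  have "K \<subseteq> (\<lambda>y. x + t *\<^sub>R y) ` L \<longleftrightarrow> (\<lambda>y. (- (1 / t)) *\<^sub>R x + (1 / t) *\<^sub>R y) ` K \<subseteq> L"
  proof safe
    fix y assume "K \<subseteq> (\<lambda>y. x + t *\<^sub>R y) ` L" "y \<in> K"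
    then obtain z where "z \<in> L" "y = x + t *\<^sub>R z" by blast
    then show "(- (1 / t)) *\<^sub>R x + (1 / t) *\<^sub>R y \<in> L"
      using t by (simp add: scaleR_add_right)
  next
    fix y assume "(\<lambda>y. (- (1 / t)) *\<^sub>R x + (1 / t) *\<^sub>R y) ` K \<subseteq> L" "y \<in> K"
    then show "y \<in> (\<lambda>y. x + t *\<^sub>R y) ` L"
      using t by (intro image_eqI[of _ _ "(- (1 / t)) *\<^sub>R x + (1 / t) *\<^sub>R y"])
        (auto simp: scaleR_diff_right)
  qed
  also have "\<dots> \<longleftrightarrow> (\<forall>\<theta>. unit_vec \<theta> \<bullet> ((- (1 / t)) *\<^sub>R x) + 1 / t * support_angle K \<theta> \<le> support_angle L \<theta>)"
    using t by (intro subset_iff_support_angle L K) simp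
  also have "\<dots> \<longleftrightarrow> (\<forall>\<theta>. support_angle K \<theta> \<le> unit_vec \<theta> \<bullet> x + t * support_angle L \<theta>)"
    by (rule arg_cong[of _ _ All], rule ext) (use t in \<open>simp add: field_simps\<close>)
  finally show ?thesis .
qed

lemma homothetic_iff_support_angle:
  assumes K: "convex_body K" and L: "convex_body L" and t: "t > 0"
  shows "K = (\<lambda>y. t *\<^sub>R y + x) ` L \<longleftrightarrow>
      (\<forall>\<theta>. support_angle K \<theta> = t * support_angle L \<theta> + unit_vec \<theta> \<bullet> x)"
proof -
  have "K = (\<lambda>y. x + t *\<^sub>R y) ` L \<longleftrightarrow> (\<lambda>y. x + t *\<^sub>R y) ` L \<subseteq> K \<and> K \<subseteq> (\<lambda>y. x + t *\<^sub>R y) ` L"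
    by blast
  also have "\<dots> \<longleftrightarrow> (\<forall>\<theta>. support_angle K \<theta> = t * support_angle L \<theta> + unit_vec \<theta> \<bullet> x)"
    unfolding subset_iff_support_angle[OF assms] supset_iff_support_angle[OF assms]
    by (auto simp: order_eq_iff algebra_simps)
  finally show ?thesis by (simp add: add.commute)
qed

lemma homothetic_iff:
  assumes "convex_body K" "convex_body L"
  shows "homothetic K L \<longleftrightarrow>
    (\<exists>c>0. \<exists>x. \<forall>\<theta>. support_angle K \<theta> = c * support_angle L \<theta> + unit_vec \<theta> \<bullet> x)"
  unfolding homothetic_def using homothetic_iff_support_angle[OF assms] by blast

lemma dilates_iff:
  assumes "convex_body K" "convex_body L"
  shows "dilates K L \<longleftrightarrow> (\<exists>c>0. \<forall>\<theta>. support_angle K \<theta> = c * support_angle L \<theta>)"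
  unfolding dilates_def using homothetic_iff_support_angle[OF assms, of _ 0]
  by (intro ex_cong1 conj_cong) simp_all

lemma support_angle_pos:
  assumes "convex_body K" "0 \<in> interior K"
  shows "support_angle K \<theta> > 0"
proof -
  obtain e where e: "e > 0" "ball 0 e \<subseteq> K" using assms(2) unfolding mem_interior by blast
  have "(e / 2) *\<^sub>R unit_vec \<theta> \<in> K" using e by (intro subsetD[OF e(2)]) simp
  from support_angle_upper[OF convex_bodyD(1,3)[OF assms(1)] this, of \<theta>] show ?thesis
    using e(1) by (simp add: norm_eq_1[THEN iffD1, OF norm_unit_vec])
qed

section \<open>The support function of a smooth body\<close>

lemma has_vector_derivative_nth:
  fixes f :: "real \<Rightarrow> real^'n"
  assumes "(f has_vector_derivative d) (at t)"
  shows "((\<lambda>t. f t $ i) has_real_derivative d $ i) (at t)"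
  using bounded_linear.has_vector_derivative[OF bounded_linear_vec_nth assms]
  by (simp add: has_real_derivative_iff_has_vector_derivative)

lemma velocity_periodic:
  assumes "\<And>t. (\<gamma> has_vector_derivative velocity \<gamma> t) (at t)" "\<And>t. \<gamma> (t + p) = \<gamma> t"
  shows "velocity \<gamma> (t + p) = velocity \<gamma> t"
proof -
  have "((\<lambda>s. s + p) has_vector_derivative 1) (at t)"
    by (auto intro!: derivative_eq_intros)
  from vector_diff_chain_at[OF this, of \<gamma> "velocity \<gamma> (t + p)"] assms(1)
  have "((\<gamma> \<circ> (\<lambda>s. s + p)) has_vector_derivative velocity \<gamma> (t + p)) (at t)" by simp
  moreover have "\<gamma> \<circ> (\<lambda>s. s + p) = \<gamma>" using assms(2) by auto
  ultimately show ?thesis using assms(1) vector_derivative_unique_at by metis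
qed

section \<open>The Gauss map of a boundary parametrization\<close>

context
  fixes K :: "(real^2) set" and \<gamma> :: "real \<Rightarrow> real^2"
  assumes param: "boundary_param K \<gamma>"
begin

lemma boundary_paramD:
  shows "(\<gamma> has_vector_derivative velocity \<gamma> t) (at t)"
    and "(velocity \<gamma> has_vector_derivative velocity (velocity \<gamma>) t) (at t)"
    and "continuous_on UNIV (velocity (velocity \<gamma>))"
    and "\<gamma> (t + 2 * pi) = \<gamma> t"
    and "range \<gamma> = frontier K"
    and "norm (velocity \<gamma> t) > 0"
    and "signed_curvature \<gamma> t > 0"
proof -
  have *: "(velocity ^^ n) \<gamma> differentiable at t" for n t
    using param unfolding boundary_param_def smooth_curve_def by blast
  show "(\<gamma> has_vector_derivative velocity \<gamma> t) (at t)"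
    using *[of 0] by (simp add: vector_derivative_works velocity_def)
  show "(velocity \<gamma> has_vector_derivative velocity (velocity \<gamma>) t) (at t)"
    using *[of 1] by (simp add: vector_derivative_works velocity_def[of "velocity \<gamma>"])
  show "continuous_on UNIV (velocity (velocity \<gamma>))"
    using *[of 2] by (auto simp: numeral_2_eq_2 intro!: continuous_at_imp_continuous_on
        differentiable_imp_continuous_within)
qed (use param in \<open>auto simp: boundary_param_def\<close>)

text \<open>Curvature times speed: the rate at which the normal angle changes with the
  parameter.\<close>

definition turning :: "real \<Rightarrow> real" where
  "turning t = signed_curvature \<gamma> t * norm (velocity \<gamma> t)"

lemma turning_pos: "turning t > 0"
  unfolding turning_def using boundary_paramD by simp

lemma continuous_velocity: "continuous_on S (velocity \<gamma>)"
  by (intro continuous_at_imp_continuous_on ballI has_vector_derivative_continuous[OF boundary_paramD(2)])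

lemma continuous_signed_curvature: "continuous_on S (signed_curvature \<gamma>)"
proof -
  have "continuous_on S (velocity (velocity \<gamma>))"
    using boundary_paramD(3) continuous_on_subset by blast
  then show ?thesis
    unfolding signed_curvature_def Let_def
    using boundary_paramD(6) by (intro continuous_intros continuous_velocity) auto
qed

lemma continuous_turning: "continuous_on S turning"
  unfolding turning_def by (intro continuous_intros continuous_velocity continuous_signed_curvature)

lemma turning_periodic: "turning (t + 2 * pi) = turning t"
proof -
  have 1: "velocity \<gamma> (t + 2 * pi) = velocity \<gamma> t" for t
    by (rule velocity_periodic) (rule boundary_paramD)+
  have 2: "velocity (velocity \<gamma>) (t + 2 * pi) = velocity (velocity \<gamma>) t" for t
    by (rule velocity_periodic) (rule boundary_paramD 1)+
  show ?thesis unfolding turning_def signed_curvature_def 1 2 ..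
qed

text \<open>The planar Frenet equation T' = \<open>turning\<close> N in coordinates, N being T
  rotated by a quarter turn.\<close>

lemma unit_tangent_deriv:
  defines "n \<equiv> \<lambda>t. norm (velocity \<gamma> t)"
  shows "((\<lambda>t. velocity \<gamma> t $ 1 / n t) has_real_derivative - turning t * (velocity \<gamma> t $ 2 / n t)) (at t)"
    and "((\<lambda>t. velocity \<gamma> t $ 2 / n t) has_real_derivative turning t * (velocity \<gamma> t $ 1 / n t)) (at t)"
proof -
  let ?v = "velocity \<gamma>" and ?a = "velocity (velocity \<gamma>)"
  have n: "n t > 0" for t unfolding n_def by (rule boundary_paramD)
  have sq: "(n t)\<^sup>2 = (?v t $ 1)\<^sup>2 + (?v t $ 2)\<^sup>2" for t
    unfolding n_def by (rule norm_vec2)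
  have n_eq: "n = (\<lambda>t. sqrt ((?v t $ 1)\<^sup>2 + (?v t $ 2)\<^sup>2))"
  proof
    fix t show "n t = sqrt ((?v t $ 1)\<^sup>2 + (?v t $ 2)\<^sup>2)"
      using n[of t] unfolding sq[symmetric] by simp
  qed
  have d1: "((\<lambda>t. ?v t $ 1) has_real_derivative ?a t $ 1) (at t)"
    and d2: "((\<lambda>t. ?v t $ 2) has_real_derivative ?a t $ 2) (at t)"
    by (rule has_vector_derivative_nth boundary_paramD(2))+
  have half: "inverse q / 2 * (2 * p) = p / q" for p q :: real by (simp add: field_simps)
  have pos: "(?v t $ 1)\<^sup>2 + (?v t $ 2)\<^sup>2 > 0" using n[of t] unfolding sq[symmetric] by simp
  have "((\<lambda>t. (?v t $ 1)\<^sup>2 + (?v t $ 2)\<^sup>2) has_real_derivative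
      2 * (?v t $ 1 * ?a t $ 1 + ?v t $ 2 * ?a t $ 2)) (at t)"
    by (auto intro!: derivative_eq_intros d1 d2)
  note dsqrt = DERIV_chain2[OF DERIV_real_sqrt[OF pos] this]
  have dn: "(n has_real_derivative (?v t $ 1 * ?a t $ 1 + ?v t $ 2 * ?a t $ 2) / n t) (at t)"
    unfolding n_eq by (rule DERIV_cong[OF dsqrt]) (rule half)
  have \<omega>: "turning t = (?v t $ 1 * ?a t $ 2 - ?v t $ 2 * ?a t $ 1) / (n t)\<^sup>2"
    using n[of t] unfolding turning_def signed_curvature_def Let_def n_def
    by (simp add: power2_eq_square power3_eq_cube)
  have key: "(d * n t - p * ((?v t $ 1 * ?a t $ 1 + ?v t $ 2 * ?a t $ 2) / n t)) / (n t * n t)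
      = (d * ((?v t $ 1)\<^sup>2 + (?v t $ 2)\<^sup>2) - p * (?v t $ 1 * ?a t $ 1 + ?v t $ 2 * ?a t $ 2)) / (n t)\<^sup>2 / n t" for d p
    unfolding sq[symmetric] using n[of t] by (simp add: field_simps power2_eq_square)
  show "((\<lambda>t. ?v t $ 1 / n t) has_real_derivative - turning t * (?v t $ 2 / n t)) (at t)"
  proof (rule DERIV_cong[OF DERIV_divide[OF d1 dn]])
    show "(?a t $ 1 * n t - ?v t $ 1 * ((?v t $ 1 * ?a t $ 1 + ?v t $ 2 * ?a t $ 2) / n t)) / (n t * n t)
        = - turning t * (?v t $ 2 / n t)"
    proof -
      have "?a t $ 1 * ((?v t $ 1)\<^sup>2 + (?v t $ 2)\<^sup>2) - ?v t $ 1 * (?v t $ 1 * ?a t $ 1 + ?v t $ 2 * ?a t $ 2)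
          = - ((?v t $ 1 * ?a t $ 2 - ?v t $ 2 * ?a t $ 1) * ?v t $ 2)"
        by (simp add: power2_eq_square algebra_simps)
      then show ?thesis unfolding key \<omega> by (simp del: minus_diff_eq)
    qed
  qed (use n[of t] in simp)
  show "((\<lambda>t. ?v t $ 2 / n t) has_real_derivative turning t * (?v t $ 1 / n t)) (at t)"
  proof (rule DERIV_cong[OF DERIV_divide[OF d2 dn]])
    show "(?a t $ 2 * n t - ?v t $ 2 * ((?v t $ 1 * ?a t $ 1 + ?v t $ 2 * ?a t $ 2) / n t)) / (n t * n t)
        = turning t * (?v t $ 1 / n t)"
    proof -
      have "?a t $ 2 * ((?v t $ 1)\<^sup>2 + (?v t $ 2)\<^sup>2) - ?v t $ 2 * (?v t $ 1 * ?a t $ 1 + ?v t $ 2 * ?a t $ 2)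
          = (?v t $ 1 * ?a t $ 2 - ?v t $ 2 * ?a t $ 1) * ?v t $ 1"
        by (simp add: power2_eq_square algebra_simps)
      then show ?thesis unfolding key \<omega> by simp
    qed
  qed (use n[of t] in simp)
qed

text \<open>The angle is an antiderivative of \<open>turning\<close>, normalized at parameter 0. It
  is the angle of the outer normal: the unit tangent of a counterclockwise curve is then (- sin,
  cos).\<close>

lemma tangent_angle:
  obtains \<phi> where "\<And>t. (\<phi> has_real_derivative turning t) (at t)"
    "\<And>t. velocity \<gamma> t $ 1 = - norm (velocity \<gamma> t) * sin (\<phi> t)"
    "\<And>t. velocity \<gamma> t $ 2 = norm (velocity \<gamma> t) * cos (\<phi> t)"
proof -
  have "isCont turning x" for x
    using continuous_turning[of UNIV] by (simp add: continuous_on_eq_continuous_at)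
  then obtain F where F: "\<And>t. (F has_real_derivative turning t) (at t)"
    using einterval_antiderivative[of "-\<infinity>" \<infinity> turning]
    by (auto simp: has_real_derivative_iff_has_vector_derivative)
  define T where "T i t = velocity \<gamma> t $ i / norm (velocity \<gamma> t)" for i t
  have n: "norm (velocity \<gamma> t) > 0" for t by (rule boundary_paramD)
  have T1: "(T 1 t)\<^sup>2 + (T 2 t)\<^sup>2 = 1" for t
    unfolding T_def using n[of t] by (intro normalized_vec2) simp
  have "(T 2 0)\<^sup>2 + (- T 1 0)\<^sup>2 = 1" using T1[of 0] by simp
  then obtain \<phi>0 where \<phi>0: "T 2 0 = cos \<phi>0" "- T 1 0 = sin \<phi>0"
    by (rule sincos_total_2pi)
  then have \<phi>0': "T 1 0 = - sin \<phi>0" by simp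
  define \<phi> where "\<phi> t = F t - F 0 + \<phi>0" for t
  have \<phi>: "(\<phi> has_real_derivative turning t) (at t)" for t
    unfolding \<phi>_def by (auto intro!: derivative_eq_intros F)
  have dT: "(T 1 has_real_derivative - turning t * T 2 t) (at t)"
      "(T 2 has_real_derivative turning t * T 1 t) (at t)" for t
    unfolding T_def by (rule unit_tangent_deriv)+
  \<comment> \<open>The inner product of the unit tangent with the expected vector (- sin \<phi>,
    cos \<phi>). It is constant by the Frenet equations, and unit vectors with inner product 1
    coincide, the squared distance being 2 - 2 D.\<close>
  define D where "D t = T 2 t * cos (\<phi> t) - T 1 t * sin (\<phi> t)" for t
  have "(D has_real_derivative 0) (at t)" for t
  proof -
    have "(D has_real_derivative
       (turning t * T 1 t * cos (\<phi> t) + T 2 t * (- sin (\<phi> t) * turning t))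
       - (- turning t * T 2 t * sin (\<phi> t) + T 1 t * (cos (\<phi> t) * turning t))) (at t)"
      unfolding D_def by (auto intro!: derivative_eq_intros dT \<phi>)
    then show ?thesis by (simp add: algebra_simps)
  qed
  then have "D t = D 0" for t by (intro DERIV_isconst_all allI)
  moreover have "D 0 = 1"
    unfolding D_def \<phi>_def by (simp add: \<phi>0(1) \<phi>0' power2_eq_square[symmetric])
  ultimately have D: "D t = 1" for t by simp
  have "(T 1 t + sin (\<phi> t))\<^sup>2 + (T 2 t - cos (\<phi> t))\<^sup>2 = 0" for t
  proof -
    have "(T 1 t + sin (\<phi> t))\<^sup>2 + (T 2 t - cos (\<phi> t))\<^sup>2
        = ((T 1 t)\<^sup>2 + (T 2 t)\<^sup>2) + ((sin (\<phi> t))\<^sup>2 + (cos (\<phi> t))\<^sup>2) - 2 * D t"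
      unfolding D_def by (simp only: power2_sum power2_diff) (simp only: algebra_simps)
    then show ?thesis unfolding T1 D by simp
  qed
  then have "T 1 t + sin (\<phi> t) = 0 \<and> T 2 t - cos (\<phi> t) = 0" for t
    by (simp only: sum_power2_eq_zero_iff)
  then have T: "T 1 t = - sin (\<phi> t)" "T 2 t = cos (\<phi> t)" for t
    by (auto simp: add_eq_0_iff2)
  have "velocity \<gamma> t $ i = norm (velocity \<gamma> t) * T i t" for t i
    using n[of t] unfolding T_def by simp
  then have "velocity \<gamma> t $ 1 = - norm (velocity \<gamma> t) * sin (\<phi> t)"
    "velocity \<gamma> t $ 2 = norm (velocity \<gamma> t) * cos (\<phi> t)" for t
    by (simp_all add: T)
  with \<phi> show ?thesis using that by blast
qed


lemma frontier_normal:
  assumes K: "convex_body K"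
  obtains \<theta> where "unit_vec \<theta> \<bullet> \<gamma> t = support_angle K \<theta>"
proof -
  note K' = convex_bodyD[OF K]
  have "\<gamma> t \<in> frontier K" using boundary_paramD(5) by blast
  then have "\<gamma> t \<in> K" "\<gamma> t \<notin> interior K"
    using compact_imp_closed[OF K'(1)] by (auto simp: frontier_def)
  moreover have "rel_interior K = interior K"
    using K by (intro rel_interior_nonempty_interior) (simp add: convex_body_def)
  ultimately obtain a where a: "a \<noteq> 0" "\<And>y. y \<in> K \<Longrightarrow> a \<bullet> \<gamma> t \<le> a \<bullet> y"
    using supporting_hyperplane_rel_boundary[OF K'(2)] by metis
  obtain \<theta> where \<theta>: "- a = norm (- a) *\<^sub>R unit_vec \<theta>" by (rule polar_decomposition)
  have "unit_vec \<theta> \<bullet> y \<le> unit_vec \<theta> \<bullet> \<gamma> t" if "y \<in> K" for y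
  proof -
    have "(- a) \<bullet> y \<le> (- a) \<bullet> \<gamma> t" using a(2)[OF that] by simp
    then have "norm (- a) * (unit_vec \<theta> \<bullet> y) \<le> norm (- a) * (unit_vec \<theta> \<bullet> \<gamma> t)"
      by (subst (asm) (1 2) \<theta>) simp
    then show ?thesis using a(1) by simp
  qed
  then have "support_angle K \<theta> \<le> unit_vec \<theta> \<bullet> \<gamma> t"
    by (rule support_angle_leI[OF K'(1,3)])
  with support_angle_upper[OF K'(1,3) \<open>\<gamma> t \<in> K\<close>, of \<theta>] show ?thesis
    by (intro that[of \<theta>]) simp
qed

text \<open>The normal angle \<phi> is strictly increasing and gains the same c > 0 over every
  period, so it is unbounded in both directions and a bijection of the line with differentiable
  inverse \<tau>. If \<theta> is a supporting direction at parameter t, the first-order condition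
  for the maximum of \<open>unit_vec \<theta> \<bullet> \<gamma>\<close> leaves only \<phi> t and
  its opposite; positive curvature rules out the opposite.\<close>

lemma gauss_map:
  assumes K: "convex_body K"
  obtains \<phi> \<tau> where "\<And>t. (\<phi> has_real_derivative turning t) (at t)"
    "\<And>t. velocity \<gamma> t $ 1 = - norm (velocity \<gamma> t) * sin (\<phi> t)"
    "\<And>t. velocity \<gamma> t $ 2 = norm (velocity \<gamma> t) * cos (\<phi> t)"
    "\<And>t. \<tau> (\<phi> t) = t" "\<And>\<theta>. \<phi> (\<tau> \<theta>) = \<theta>"
    "\<And>\<theta>. (\<tau> has_real_derivative 1 / turning (\<tau> \<theta>)) (at \<theta>)"
    "\<And>\<theta> t. unit_vec \<theta> \<bullet> \<gamma> t = support_angle K \<theta> \<Longrightarrow> unit_vec (\<phi> t) = unit_vec \<theta>"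
proof -
  note K' = convex_bodyD[OF K]
  obtain \<phi> where \<phi>: "\<And>t. (\<phi> has_real_derivative turning t) (at t)"
    and v: "\<And>t. velocity \<gamma> t $ 1 = - norm (velocity \<gamma> t) * sin (\<phi> t)"
     "\<And>t. velocity \<gamma> t $ 2 = norm (velocity \<gamma> t) * cos (\<phi> t)"
    using tangent_angle by metis
  have incr: "\<phi> s < \<phi> t" if "s < t" for s t
    using that by (rule DERIV_pos_imp_increasing) (use \<phi> turning_pos in blast)
  have cont: "continuous_on S \<phi>" for S
    by (rule DERIV_continuous_on) (rule has_field_derivative_at_within[OF \<phi>])
  define c where "c = \<phi> (2 * pi) - \<phi> 0"
  have c: "c > 0" unfolding c_def using incr[of 0 "2 * pi"] by simp
  have "((\<lambda>t. \<phi> (t + 2 * pi) - \<phi> t) has_real_derivative 0) (at t)" for t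
  proof -
    have "((\<lambda>t. \<phi> (t + 2 * pi)) has_real_derivative turning (t + 2 * pi)) (at t)"
      using \<phi> DERIV_shift by blast
    from DERIV_diff[OF this \<phi>] show ?thesis by (simp add: turning_periodic)
  qed
  then have "\<phi> (t + 2 * pi) - \<phi> t = \<phi> (0 + 2 * pi) - \<phi> 0" for t
    by (intro DERIV_isconst_all allI)
  then have shift: "\<phi> (t + 2 * pi) = \<phi> t + c" for t
    by (simp add: c_def algebra_simps)
  have upper: "\<phi> (2 * pi * real n) = \<phi> 0 + real n * c" for n
  proof (induction n)
    case (Suc n)
    then show ?case using shift[of "2 * pi * real n"] by (simp add: algebra_simps)
  qed simp
  have lower: "\<phi> (- (2 * pi * real n)) = \<phi> 0 - real n * c" for n
  proof (induction n)
    case (Suc n)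
    then show ?case using shift[of "- (2 * pi * real (Suc n))"] by (simp add: algebra_simps)
  qed simp
  have "\<exists>t. \<phi> t = \<theta>" for \<theta>
  proof -
    obtain n where n: "\<bar>\<theta> - \<phi> 0\<bar> \<le> real n * c"
      using reals_Archimedean3[OF c] less_imp_le by blast
    have "\<exists>t\<ge>- (2 * pi * real n). t \<le> 2 * pi * real n \<and> \<phi> t = \<theta>"
      by (rule IVT') (use n in \<open>auto simp: upper lower abs_le_iff cont\<close>)
    then show ?thesis by blast
  qed
  then obtain \<tau> where \<phi>\<tau>: "\<And>\<theta>. \<phi> (\<tau> \<theta>) = \<theta>" by metis
  have \<tau>\<phi>: "\<tau> (\<phi> t) = t" for t
    using incr[of t "\<tau> (\<phi> t)"] incr[of "\<tau> (\<phi> t)" t] \<phi>\<tau>[of "\<phi> t"] by fastforce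
  have \<tau>: "(\<tau> has_real_derivative 1 / turning (\<tau> \<theta>)) (at \<theta>)" for \<theta>
  proof -
    have "(\<tau> has_real_derivative inverse (turning (\<tau> \<theta>))) (at (\<phi> (\<tau> \<theta>)))"
      unfolding has_field_derivative_def
    proof (rule has_derivative_inverse_strong[of UNIV "\<tau> \<theta>" \<phi> \<tau>])
      show "(\<phi> has_derivative (*) (turning (\<tau> \<theta>))) (at (\<tau> \<theta>))"
        using \<phi> by (simp add: has_field_derivative_def)
    qed (use turning_pos[of "\<tau> \<theta>"] cont \<tau>\<phi> in auto)
    then show ?thesis by (simp add: \<phi>\<tau> inverse_eq_divide)
  qed
  have "unit_vec (\<phi> t) = unit_vec \<theta>" if normal: "unit_vec \<theta> \<bullet> \<gamma> t = support_angle K \<theta>" for \<theta> t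
  proof -
    define f where "f s = unit_vec \<theta> \<bullet> \<gamma> s" for s
    have f: "(f has_real_derivative norm (velocity \<gamma> s) * sin (\<theta> - \<phi> s)) (at s)" for s
    proof -
      have "(f has_real_derivative cos \<theta> * velocity \<gamma> s $ 1 + sin \<theta> * velocity \<gamma> s $ 2) (at s)"
        unfolding f_def inner_unit_vec
        by (intro DERIV_add DERIV_cmult has_vector_derivative_nth boundary_paramD)
      then show ?thesis by (simp add: v[of s] sin_diff algebra_simps)
    qed
    have "\<gamma> s \<in> K" for s
      using boundary_paramD(5) frontier_subset_closed[OF compact_imp_closed[OF K'(1)]] by blast
    then have max: "f s \<le> f t" for s
      using support_angle_upper[OF K'(1,3)] normal by (simp add: f_def)
    have "norm (velocity \<gamma> t) * sin (\<theta> - \<phi> t) = 0"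
      by (rule DERIV_local_max[OF f zero_less_one]) (use max in auto)
    then have sin0: "sin (\<theta> - \<phi> t) = 0" using boundary_paramD(6)[of t] by simp
    \<comment> \<open>If \<theta> were opposite to the normal, f would increase from t until the
      normal has turned by \<pi>, at the parameter s, contradicting maximality at t.\<close>
    have "cos (\<theta> - \<phi> t) \<noteq> -1"
    proof
      assume cos: "cos (\<theta> - \<phi> t) = -1"
      define s where "s = \<tau> (\<phi> t + pi)"
      have "\<phi> t < \<phi> s" unfolding s_def by (simp add: \<phi>\<tau>)
      then have "t < s" using incr[of s t] by (cases s t rule: linorder_cases) auto
      then have "f t < f s"
      proof (rule DERIV_pos_imp_increasing_open[of t s f])
        fix x assume x: "t < x" "x < s"
        have "\<phi> t < \<phi> x" "\<phi> x < \<phi> t + pi"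
          using incr[OF x(1)] incr[OF x(2)] by (simp_all add: s_def \<phi>\<tau>)
        then have "sin (\<phi> x - \<phi> t) > 0" by (intro sin_gt_zero) auto
        moreover have "sin (\<theta> - \<phi> x) = sin (\<phi> x - \<phi> t)"
          using sin_diff[of "\<theta> - \<phi> t" "\<phi> x - \<phi> t"] unfolding sin0 cos by simp
        ultimately show "\<exists>y. (f has_real_derivative y) (at x) \<and> 0 < y"
          using f[of x] boundary_paramD(6)[of x]
          by (intro exI[of _ "norm (velocity \<gamma> x) * sin (\<theta> - \<phi> x)"]) simp
      qed (rule DERIV_continuous_on, rule has_field_derivative_at_within, rule f)
      with max[of s] show False by simp
    qed
    moreover have "(cos (\<theta> - \<phi> t))\<^sup>2 = 1"
      using sin_cos_squared_add[of "\<theta> - \<phi> t"] unfolding sin0 by simp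
    ultimately have cos1: "cos (\<theta> - \<phi> t) = 1" by (auto simp: power2_eq_1_iff)
    have "cos \<theta> = cos (\<phi> t)" "sin \<theta> = sin (\<phi> t)"
      using cos_add[of "\<theta> - \<phi> t" "\<phi> t"] sin_add[of "\<theta> - \<phi> t" "\<phi> t"]
      unfolding sin0 cos1 by simp_all
    then show ?thesis by (simp add: vec_eq_iff forall_2)
  qed
  from \<phi> v \<tau>\<phi> \<phi>\<tau> \<tau> this show ?thesis by (rule that)
qed

text \<open>In terms of the normal angle, the support function is h = u \<bullet> \<gamma>(\<tau>).
  The velocity is orthogonal to u, so h' = u' \<bullet> \<gamma>(\<tau>), and one more derivative of
  this formula gives h'' = 1 / \<kappa> - h. Two derivatives of h thus cost only one derivative of
  \<tau>.\<close>

lemma boundary_param_support_angle: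
  assumes K: "convex_body K"
  shows "C2_periodic (support_angle K)"
    and "\<exists>t. unit_vec \<theta> \<bullet> \<gamma> t = support_angle K \<theta>"
    and "unit_vec \<theta> \<bullet> \<gamma> t = support_angle K \<theta> \<Longrightarrow>
      signed_curvature \<gamma> t = 1 / curv_radius (support_angle K) \<theta>"
proof -
  obtain \<phi> \<tau> where \<phi>: "\<And>t. (\<phi> has_real_derivative turning t) (at t)"
    and v: "\<And>t. velocity \<gamma> t $ 1 = - norm (velocity \<gamma> t) * sin (\<phi> t)"
     "\<And>t. velocity \<gamma> t $ 2 = norm (velocity \<gamma> t) * cos (\<phi> t)"
    and inv: "\<And>t. \<tau> (\<phi> t) = t" "\<And>\<theta>. \<phi> (\<tau> \<theta>) = \<theta>"
    and \<tau>: "\<And>\<theta>. (\<tau> has_real_derivative 1 / turning (\<tau> \<theta>)) (at \<theta>)"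
    and normal: "\<And>\<theta> t. unit_vec \<theta> \<bullet> \<gamma> t = support_angle K \<theta> \<Longrightarrow> unit_vec (\<phi> t) = unit_vec \<theta>"
    by (rule gauss_map[OF K]) (rule that)
  \<comment> \<open>Each boundary point has some supporting direction, and the Gauss map identifies
    it with the direction of \<phi> t.\<close>
  have \<gamma>\<phi>: "unit_vec (\<phi> t) \<bullet> \<gamma> t = support_angle K (\<phi> t)" for t
    using frontier_normal[OF K, of t] normal unfolding support_angle_def by metis
  then show "\<exists>t. unit_vec \<theta> \<bullet> \<gamma> t = support_angle K \<theta>"
    using inv(2) by metis
  let ?h = "support_angle K"
  let ?x = "\<lambda>\<theta>. \<gamma> (\<tau> \<theta>) $ 1" and ?y = "\<lambda>\<theta>. \<gamma> (\<tau> \<theta>) $ 2"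
  define \<kappa> where "\<kappa> \<theta> = signed_curvature \<gamma> (\<tau> \<theta>)" for \<theta>
  have \<kappa>: "\<kappa> \<theta> > 0" for \<theta> unfolding \<kappa>_def by (rule boundary_paramD)
  have h: "?h \<theta> = cos \<theta> * ?x \<theta> + sin \<theta> * ?y \<theta>" for \<theta>
    using \<gamma>\<phi>[of "\<tau> \<theta>"] unfolding inv(2) inner_unit_vec by simp
  have deriv: "((\<lambda>\<theta>. \<gamma> (\<tau> \<theta>) $ i) has_real_derivative
      velocity \<gamma> (\<tau> \<theta>) $ i * (1 / turning (\<tau> \<theta>))) (at \<theta>)" for i \<theta>
    by (rule DERIV_chain2[OF has_vector_derivative_nth[OF boundary_paramD(1)] \<tau>])
  have dx: "(?x has_real_derivative - sin \<theta> / \<kappa> \<theta>) (at \<theta>)"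
    and dy: "(?y has_real_derivative cos \<theta> / \<kappa> \<theta>) (at \<theta>)" for \<theta>
    using deriv[of 1 \<theta>] deriv[of 2 \<theta>] v[of "\<tau> \<theta>"] boundary_paramD(6)[of "\<tau> \<theta>"]
    unfolding turning_def \<kappa>_def by (simp_all add: inv)
  have 1: "(?h has_real_derivative - sin \<theta> * ?x \<theta> + cos \<theta> * ?y \<theta>) (at \<theta>)" for \<theta>
    unfolding h[abs_def] by (auto intro!: derivative_eq_intros dx dy)
  have 2: "((\<lambda>\<theta>. - sin \<theta> * ?x \<theta> + cos \<theta> * ?y \<theta>) has_real_derivative 1 / \<kappa> \<theta> - ?h \<theta>) (at \<theta>)" for \<theta>
  proof -
    have "((\<lambda>\<theta>. - sin \<theta> * ?x \<theta> + cos \<theta> * ?y \<theta>) has_real_derivative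
        (- cos \<theta> * ?x \<theta> + - sin \<theta> * (- sin \<theta> / \<kappa> \<theta>)) + (- sin \<theta> * ?y \<theta> + cos \<theta> * (cos \<theta> / \<kappa> \<theta>))) (at \<theta>)"
      by (auto intro!: derivative_eq_intros dx dy)
    moreover have "- sin \<theta> * (- sin \<theta> / \<kappa> \<theta>) + cos \<theta> * (cos \<theta> / \<kappa> \<theta>) = 1 / \<kappa> \<theta>"
      by (simp add: add_divide_distrib[symmetric] power2_eq_square[symmetric])
    ultimately show ?thesis unfolding h by (simp add: algebra_simps)
  qed
  have cont_\<kappa>: "continuous_on UNIV \<kappa>"
    unfolding \<kappa>_def
  proof (rule continuous_on_compose2[OF continuous_signed_curvature[of UNIV]])
    show "continuous_on UNIV \<tau>"
      by (rule DERIV_continuous_on, rule has_field_derivative_at_within, rule \<tau>)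
  qed simp
  have "continuous_on UNIV ?h"
    by (rule DERIV_continuous_on) (rule has_field_derivative_at_within[OF 1])
  then have 3: "continuous_on UNIV (\<lambda>\<theta>. 1 / \<kappa> \<theta> - ?h \<theta>)"
    by (intro continuous_intros cont_\<kappa>) (use \<kappa> in \<open>auto simp: less_imp_neq[symmetric]\<close>)
  note C2 = C2_periodicI[OF 1 2 3 support_angle_periodic]
  show "C2_periodic ?h" by (rule C2(1))
  have rad: "curv_radius ?h \<theta> = 1 / \<kappa> \<theta>" for \<theta>
    unfolding curv_radius_def C2(3) by simp
  show "signed_curvature \<gamma> t = 1 / curv_radius ?h \<theta>" if \<theta>: "unit_vec \<theta> \<bullet> \<gamma> t = ?h \<theta>"
  proof -
    obtain k where "\<phi> t = \<theta> + 2 * pi * of_int k"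
      using normal[OF \<theta>] unfolding unit_vec_eq_iff by blast
    then have "curv_radius ?h \<theta> = curv_radius ?h (\<phi> t)"
      using periodic_shift_int[of "curv_radius ?h", OF curv_radius_shift[OF C2(1)]] by metis
    then show ?thesis unfolding rad \<kappa>_def inv by simp
  qed
qed

end

text \<open>\<open>curvature\<close> is a definite description ranging over all parametrizations;
  the value \<open>1 / curv_radius\<close> mentions none of them, so all candidates agree.\<close>

lemma
  assumes "admissible_body K"
  shows admissible_regular_support: "regular_support (support_angle K)"
    and curvature_unit_vec: "curvature K (unit_vec \<theta>) = 1 / curv_radius (support_angle K) \<theta>"
proof -
  have K: "convex_body K" "0 \<in> interior K" and "smooth_body K"
    using assms unfolding admissible_body_def by auto
  then obtain \<gamma> where \<gamma>: "boundary_param K \<gamma>" unfolding smooth_body_def by blast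
  note * = boundary_param_support_angle[OF _ K(1)]
  obtain t where t: "\<And>\<theta>. unit_vec \<theta> \<bullet> \<gamma> (t \<theta>) = support_angle K \<theta>"
    using *(2)[OF \<gamma>] by metis
  have "curv_radius (support_angle K) \<theta> > 0" for \<theta>
    using *(3)[OF \<gamma> t] boundary_paramD(7)[OF \<gamma>, of "t \<theta>"] by (metis zero_less_divide_1_iff)
  then show "regular_support (support_angle K)"
    unfolding regular_support_def using *(1)[OF \<gamma>] support_angle_pos[OF K] by blast
  show "curvature K (unit_vec \<theta>) = 1 / curv_radius (support_angle K) \<theta>"
    unfolding curvature_def
  proof (rule the_equality)
    show "\<exists>\<gamma> t. boundary_param K \<gamma> \<and> unit_vec \<theta> \<bullet> \<gamma> t = support_fun K (unit_vec \<theta>) \<and>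
        1 / curv_radius (support_angle K) \<theta> = signed_curvature \<gamma> t"
      using \<gamma> t[of \<theta>] *(3)[OF \<gamma> t] unfolding support_angle_def[symmetric] by metis
  qed (use *(3) in \<open>auto simp: support_angle_def\<close>)
qed

section \<open>The area of a smooth body\<close>

text \<open>Fubini for pairs, carried over to \<open>real^2\<close>, where area is measured, by the
  coordinate bijection: it maps boxes to boxes of the same content.\<close>

lemma has_integral_product_vec2:
  fixes f g :: "real \<Rightarrow> real"
  assumes f: "continuous_on {a..b} f" and g: "continuous_on {c..d} g"
  shows "((\<lambda>p. f (p $ 1) * g (p $ 2)) has_integral integral {a..b} f * integral {c..d} g)
      (cbox (vector [a, c] :: real^2) (vector [b, d]))"
proof -
  define to_pair :: "real^2 \<Rightarrow> real \<times> real" where "to_pair p = (p $ 1, p $ 2)" for p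
  define of_pair :: "real \<times> real \<Rightarrow> real^2" where "of_pair q = vector [fst q, snd q]" for q
  have inv: "of_pair (to_pair p) = p" "to_pair (of_pair q) = q" for p q
    by (simp_all add: to_pair_def of_pair_def vec_eq_iff forall_2)
  have of_box: "of_pair ` cbox (x, y) (z, w) = cbox (vector [x, y]) (vector [z, w])" for x y z w
  proof (rule set_eqI)
    fix p
    have "p \<in> of_pair ` cbox (x, y) (z, w) \<longleftrightarrow> to_pair p \<in> cbox (x, y) (z, w)"
      by (rule iffI) (auto simp: inv intro: image_eqI[of p of_pair "to_pair p"])
    then show "p \<in> of_pair ` cbox (x, y) (z, w) \<longleftrightarrow> p \<in> cbox (vector [x, y]) (vector [z, w])"
      by (simp add: cbox_Pair_eq to_pair_def mem_box_cart forall_2)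
  qed
  have to_box: "to_pair ` cbox u v = cbox (u $ 1, u $ 2) (v $ 1, v $ 2)" for u v
  proof (rule set_eqI)
    fix q
    have "q \<in> to_pair ` cbox u v \<longleftrightarrow> of_pair q \<in> cbox u v"
      by (rule iffI) (auto simp: inv intro: image_eqI[of q to_pair "of_pair q"])
    then show "q \<in> to_pair ` cbox u v \<longleftrightarrow> q \<in> cbox (u $ 1, u $ 2) (v $ 1, v $ 2)"
      by (cases q) (simp add: cbox_Pair_eq of_pair_def mem_box_cart forall_2)
  qed
  have cont: "continuous_on (cbox (a, c) (b, d)) (\<lambda>q. f (fst q) * g (snd q))"
    unfolding cbox_Pair_eq
    by (intro continuous_intros continuous_on_compose2[OF f] continuous_on_compose2[OF g]) auto
  have "((\<lambda>p. (\<lambda>q. f (fst q) * g (snd q)) (to_pair p)) has_integral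
      (1 / 1) *\<^sub>R integral (cbox (a, c) (b, d)) (\<lambda>q. f (fst q) * g (snd q))) (of_pair ` cbox (a, c) (b, d))"
  proof (rule has_integral_twiddle)
    show "continuous (at x) to_pair" for x
      unfolding to_pair_def by (intro continuous_intros)
    show "\<exists>w z. to_pair ` cbox u v = cbox w z" for u v using to_box by blast
    show "\<exists>w z. of_pair ` cbox u v = cbox w z" for u v
      using of_box by (cases u, cases v) blast
    show "measure lborel (to_pair ` cbox u v) = 1 * measure lborel (cbox u v)" for u v
    proof -
      have "cbox u v = {} \<longleftrightarrow> \<not> (\<forall>i. u $ i \<le> v $ i)"
        unfolding interval_eq_empty_cart by (simp add: not_le)
      then show ?thesis
        unfolding to_box content_Pair content_cbox_if_cart
        by (simp add: forall_2 UNIV_2 content_real_if)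
    qed
  qed (use inv integrable_integral[OF integrable_continuous[OF cont]] in auto)
  moreover have "integral (cbox (a, c) (b, d)) (\<lambda>q. f (fst q) * g (snd q))
      = integral {a..b} f * integral {c..d} g"
    unfolding integral_prod_continuous[OF cont] by simp
  ultimately show ?thesis by (simp add: of_box to_pair_def)
qed

text \<open>The inverse Gauss map h u + h' u', with u' the unit tangent; equivalently the gradient
  at u of the homogeneous support function.\<close>

definition boundary_point :: "(real \<Rightarrow> real) \<Rightarrow> real \<Rightarrow> real^2" where
  "boundary_point h \<theta> = vector [h \<theta> * cos \<theta> - deriv h \<theta> * sin \<theta>, h \<theta> * sin \<theta> + deriv h \<theta> * cos \<theta>]"

lemma boundary_point_nth [simp]:
  "boundary_point h \<theta> $ 1 = h \<theta> * cos \<theta> - deriv h \<theta> * sin \<theta>"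
  "boundary_point h \<theta> $ 2 = h \<theta> * sin \<theta> + deriv h \<theta> * cos \<theta>"
  by (simp_all add: boundary_point_def)

lemma cos_sin_collapse: "cos \<theta> * (cos \<theta> * x) + sin \<theta> * (sin \<theta> * x) = (x :: real)"
proof -
  have "cos \<theta> * (cos \<theta> * x) + sin \<theta> * (sin \<theta> * x) = ((sin \<theta>)\<^sup>2 + (cos \<theta>)\<^sup>2) * x"
    unfolding power2_eq_square by (simp only: algebra_simps)
  then show ?thesis by simp
qed

lemma inner_boundary_point [simp]: "unit_vec \<theta> \<bullet> boundary_point h \<theta> = h \<theta>"
proof -
  have "unit_vec \<theta> \<bullet> boundary_point h \<theta> = h \<theta> * ((sin \<theta>)\<^sup>2 + (cos \<theta>)\<^sup>2)"
    unfolding inner_unit_vec by (simp add: algebra_simps cos_sin_collapse)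
  then show ?thesis by simp
qed

lemma boundary_point_periodic:
  assumes "C2_periodic h"
  shows "boundary_point h (\<theta> + 2 * pi) = boundary_point h \<theta>"
  using assms by (simp add: boundary_point_def C2_periodic_shift C2_periodic_shift_deriv)

lemma boundary_point_deriv:
  assumes h: "C2_periodic h"
  shows "(boundary_point h has_vector_derivative
    vector [- curv_radius h \<theta> * sin \<theta>, curv_radius h \<theta> * cos \<theta>]) (at \<theta>)"
proof -
  have eq: "vector [x, y] = x *\<^sub>R (vector [1, 0] :: real^2) + y *\<^sub>R vector [0, 1]" for x y
    by (simp add: vec_eq_iff forall_2)
  have 1: "((\<lambda>\<theta>. h \<theta> * cos \<theta> - deriv h \<theta> * sin \<theta>) has_real_derivative - curv_radius h \<theta> * sin \<theta>) (at \<theta>)"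
    by (auto intro!: derivative_eq_intros C2_periodic_deriv C2_periodic_deriv2 h
        simp: curv_radius_def algebra_simps)
  have 2: "((\<lambda>\<theta>. h \<theta> * sin \<theta> + deriv h \<theta> * cos \<theta>) has_real_derivative curv_radius h \<theta> * cos \<theta>) (at \<theta>)"
    by (auto intro!: derivative_eq_intros C2_periodic_deriv C2_periodic_deriv2 h
        simp: curv_radius_def algebra_simps)
  have "((\<lambda>\<theta>. (h \<theta> * cos \<theta> - deriv h \<theta> * sin \<theta>) *\<^sub>R (vector [1, 0] :: real^2)
       + (h \<theta> * sin \<theta> + deriv h \<theta> * cos \<theta>) *\<^sub>R vector [0, 1]) has_vector_derivative
      (- curv_radius h \<theta> * sin \<theta>) *\<^sub>R vector [1, 0] + (curv_radius h \<theta> * cos \<theta>) *\<^sub>R vector [0, 1]) (at \<theta>)"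
    using has_vector_derivative_add[OF has_vector_derivative_scaleR[OF 1 has_vector_derivative_const]
        has_vector_derivative_scaleR[OF 2 has_vector_derivative_const]] by simp
  then show ?thesis unfolding eq[symmetric] boundary_point_def[abs_def] .
qed

section \<open>Polar coordinates adapted to the body\<close>

context
  fixes K :: "(real^2) set" and h :: "real \<Rightarrow> real"
  assumes K: "convex_body K" and h_def: "h = support_angle K" and h: "regular_support h"
begin

text \<open>The nonnegative function h - u \<bullet> p has a minimum at \<theta>; its vanishing
  derivative gives the tangential component of p, and the value h \<theta> gives the normal
  one.\<close>

lemma support_point_unique:
  assumes "p \<in> K" "unit_vec \<theta> \<bullet> p = h \<theta>"
  shows "p = boundary_point h \<theta>"
proof -
  let ?f = "\<lambda>s. h s - (cos s * p $ 1 + sin s * p $ 2)"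
  have "(?f has_real_derivative deriv h \<theta> - (- sin \<theta> * p $ 1 + cos \<theta> * p $ 2)) (at \<theta>)"
    by (auto intro!: derivative_eq_intros C2_periodic_deriv regular_supportD[OF h])
  moreover have "?f \<theta> \<le> ?f s" for s
    using support_angle_upper[OF convex_bodyD(1,3)[OF K] assms(1), of s] assms(2)
    by (simp add: inner_unit_vec h_def)
  ultimately have "deriv h \<theta> - (- sin \<theta> * p $ 1 + cos \<theta> * p $ 2) = 0"
    by (intro DERIV_local_min[OF _ zero_less_one]) auto
  then have d: "deriv h \<theta> = - sin \<theta> * p $ 1 + cos \<theta> * p $ 2" by simp
  have "p $ 1 * ((sin \<theta>)\<^sup>2 + (cos \<theta>)\<^sup>2) = h \<theta> * cos \<theta> - deriv h \<theta> * sin \<theta>"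
    "p $ 2 * ((sin \<theta>)\<^sup>2 + (cos \<theta>)\<^sup>2) = h \<theta> * sin \<theta> + deriv h \<theta> * cos \<theta>"
    unfolding d assms(2)[symmetric] inner_unit_vec by (simp_all add: algebra_simps cos_sin_collapse)
  then show ?thesis by (simp add: vec_eq_iff forall_2)
qed

lemma boundary_point_mem: "boundary_point h \<theta> \<in> K"
  using support_angle_attained[OF convex_bodyD(1,3)[OF K], of \<theta>] support_point_unique[of _ \<theta>]
  unfolding h_def by metis

text \<open>
  If \<open>p\<close> supports \<open>K\<close> in the directions \<open>\<alpha> < \<beta>\<close>, then \<open>f = h - u \<bullet> p\<close> vanishes to second order
  there, while \<open>f' sin (\<beta> - x) + f cos (\<beta> - x)\<close> has the positive derivative
  \<open>curv_radius h x * sin (\<beta> - x)\<close> in between.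
\<close>

lemma boundary_point_neq:
  assumes "\<alpha> < \<beta>" "\<beta> \<le> \<alpha> + pi"
  shows "boundary_point h \<alpha> \<noteq> boundary_point h \<beta>"
proof
  assume eq: "boundary_point h \<alpha> = boundary_point h \<beta>"
  define p where "p = boundary_point h \<alpha>"
  note H = regular_supportD[OF h]
  let ?f = "\<lambda>s. h s - (cos s * p $ 1 + sin s * p $ 2)"
  let ?f' = "\<lambda>s. deriv h s - (- sin s * p $ 1 + cos s * p $ 2)"
  define G where "G s = ?f' s * sin (\<beta> - s) + ?f s * cos (\<beta> - s)" for s
  have f: "(?f has_real_derivative ?f' s) (at s)" for s
    by (auto intro!: derivative_eq_intros C2_periodic_deriv H)
  have f': "(?f' has_real_derivative curv_radius h s - ?f s) (at s)" for s
    by (auto intro!: derivative_eq_intros C2_periodic_deriv2 H simp: curv_radius_def)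
  have G: "(G has_real_derivative curv_radius h s * sin (\<beta> - s)) (at s)" for s
    unfolding G_def by (rule derivative_eq_intros refl f f')+ (simp add: algebra_simps)
  have "G \<alpha> < G \<beta>"
  proof (rule DERIV_pos_imp_increasing_open[OF assms(1)])
    fix s assume s: "\<alpha> < s" "s < \<beta>"
    then have "sin (\<beta> - s) > 0" using assms by (intro sin_gt_zero) auto
    then show "\<exists>y. (G has_real_derivative y) (at s) \<and> 0 < y"
      using G[of s] H(3)[of s] by (intro exI[of _ "curv_radius h s * sin (\<beta> - s)"]) simp
  qed (rule DERIV_continuous_on, rule has_field_derivative_at_within, rule G)
  moreover have "?f \<alpha> = 0" "?f \<beta> = 0"
    using inner_boundary_point[of \<alpha> h] inner_boundary_point[of \<beta> h]
    unfolding inner_unit_vec eq[symmetric] p_def by simp_all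
  moreover have "?f' \<alpha> = 0"
  proof -
    have "- sin \<alpha> * p $ 1 + cos \<alpha> * p $ 2 = deriv h \<alpha> * ((sin \<alpha>)\<^sup>2 + (cos \<alpha>)\<^sup>2)"
      unfolding p_def by (simp add: algebra_simps cos_sin_collapse)
    then show ?thesis by simp
  qed
  ultimately show False unfolding G_def by simp
qed

text \<open>Angles more than \<pi> apart are compared the other way round the circle, from y to x +
  2 \<pi>.\<close>

lemma boundary_point_inj_on: "inj_on (boundary_point h) {0..<2 * pi}"
proof (rule linorder_inj_onI)
  fix x y assume xy: "x < y" "x \<in> {0..<2 * pi}" "y \<in> {0..<2 * pi}"
  show "boundary_point h x \<noteq> boundary_point h y"
  proof (cases "y \<le> x + pi")
    case False
    then have "boundary_point h y \<noteq> boundary_point h (x + 2 * pi)"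
      using xy by (intro boundary_point_neq) auto
    then show ?thesis using boundary_point_periodic[of h] regular_supportD(1)[OF h] by metis
  qed (use xy boundary_point_neq in auto)
qed auto

text \<open>Pairing with the normal at x gives s h(x) on one side and at most t h(x) on the other,
  so s <= t; the roles can be exchanged.\<close>

lemma scaled_boundary_point_inj:
  assumes "0 < s" "0 < t" "s *\<^sub>R boundary_point h x = t *\<^sub>R boundary_point h y"
  shows "s = t" "boundary_point h x = boundary_point h y"
proof -
  have le: "s \<le> t" if "0 < s" "0 < t" "s *\<^sub>R boundary_point h x = t *\<^sub>R boundary_point h y" for s t x y
  proof -
    have "s * h x = unit_vec x \<bullet> (s *\<^sub>R boundary_point h x)" by simp
    also have "\<dots> = t * (unit_vec x \<bullet> boundary_point h y)" unfolding that(3) by simp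
    also have "\<dots> \<le> t * h x"
      using support_angle_upper[OF convex_bodyD(1,3)[OF K] boundary_point_mem, of x y] that(2)
      unfolding h_def by simp
    finally show ?thesis using regular_supportD(2)[OF h, of x] by simp
  qed
  show "s = t" using le[OF assms] le[OF assms(2,1) assms(3)[symmetric]] by simp
  then show "boundary_point h x = boundary_point h y" using assms by simp
qed

text \<open>The factor s is the gauge of x with respect to K, found as the maximum of (u \<bullet>
  x) / h over all directions u. After division by it, x still satisfies all support inequalities and
  attains equality in the maximizing direction.\<close>

lemma scaled_boundary_point_surj:
  assumes "x \<in> K" "x \<noteq> 0"
  obtains s \<theta> where "0 < s" "s \<le> 1" "0 \<le> \<theta>" "\<theta> < 2 * pi" "x = s *\<^sub>R boundary_point h \<theta>"
proof -
  note H = regular_supportD[OF h] and K' = convex_bodyD[OF K]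
  define f where "f \<theta> = (unit_vec \<theta> \<bullet> x) / h \<theta>" for \<theta>
  have h0: "h \<theta> \<noteq> 0" for \<theta> using H(2)[of \<theta>] by simp
  have "continuous_on {0..2 * pi} f"
    unfolding f_def inner_unit_vec
    by (intro continuous_intros C2_periodic_continuous H) (use h0 in auto)
  then obtain m where m: "m \<in> {0..2 * pi}" "\<And>\<theta>. \<theta> \<in> {0..2 * pi} \<Longrightarrow> f \<theta> \<le> f m"
    using continuous_attains_sup[of "{0..2 * pi}" f] by auto
  have f_per: "f (\<theta> + 2 * pi) = f \<theta>" for \<theta>
    unfolding f_def using C2_periodic_shift[OF H(1)] by simp
  have max: "f \<theta> \<le> f m" for \<theta>
  proof -
    obtain y where "0 \<le> y" "y < 0 + 2 * pi" "f y = f \<theta>" using periodic_range[of f] f_per by metis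
    then show ?thesis using m(2)[of y] by simp
  qed
  have "f m \<le> 1"
    using support_angle_upper[OF K'(1,3) assms(1), of m] H(2)[of m] unfolding f_def h_def by simp
  have "f m > 0"
  proof -
    obtain \<phi> where \<phi>: "x = norm x *\<^sub>R unit_vec \<phi>" by (rule polar_decomposition)
    have "unit_vec \<phi> \<bullet> x = norm x"
      by (subst \<phi>) (simp add: norm_eq_1[THEN iffD1, OF norm_unit_vec])
    then have "f \<phi> > 0" unfolding f_def using assms(2) H(2)[of \<phi>] by simp
    then show ?thesis using max[of \<phi>] by linarith
  qed
  define y where "y = (1 / f m) *\<^sub>R x"
  have "unit_vec \<theta> \<bullet> y \<le> h \<theta>" for \<theta>
    using max[of \<theta>] \<open>f m > 0\<close> H(2)[of \<theta>] unfolding y_def by (simp add: f_def[of \<theta>] field_simps)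
  then have "y \<in> K" using mem_iff_support_angle[OF K'(1,3,2)] unfolding h_def by blast
  moreover have "unit_vec m \<bullet> y = h m"
    using \<open>f m > 0\<close> h0[of m] unfolding y_def by (auto simp: f_def)
  ultimately have y: "y = boundary_point h m" by (rule support_point_unique)
  obtain \<theta> where \<theta>: "0 \<le> \<theta>" "\<theta> < 0 + 2 * pi" "boundary_point h \<theta> = boundary_point h m"
    using periodic_range[of "boundary_point h"] boundary_point_periodic[OF H(1)] by metis
  have "x = f m *\<^sub>R boundary_point h \<theta>" using \<open>f m > 0\<close> unfolding \<theta>(3) y[symmetric] y_def by simp
  then show ?thesis using that[of "f m" \<theta>] \<theta> \<open>f m > 0\<close> \<open>f m \<le> 1\<close> by simp
qed

text \<open>The map (s, \<theta>) to s times the boundary point sweeps out K without the origin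
  exactly once and has Jacobian s h (h + h''). The factor 1 / 2 in \<open>mixed_area\<close> is the
  integral of s over [0, 1].\<close>

lemma area_support_angle: "measure lebesgue K = mixed_area h h"
proof -
  note H = regular_supportD[OF h] and K' = convex_bodyD[OF K]
  \<comment> \<open>Half-open in both variables: s = 0 would collapse to the origin, and \<theta> =
    2 \<pi> would repeat \<theta> = 0.\<close>
  define S where "S = {p :: real^2. 0 < p $ 1 \<and> p $ 1 \<le> 1 \<and> 0 \<le> p $ 2 \<and> p $ 2 < 2 * pi}"
  define G where "G p = p $ 1 *\<^sub>R boundary_point h (p $ 2)" for p :: "real^2"
  define d where "d \<theta> = (vector [- curv_radius h \<theta> * sin \<theta>, curv_radius h \<theta> * cos \<theta>] :: real^2)" for \<theta>
  define G' where "G' p q = p $ 1 *\<^sub>R (q $ 2 *\<^sub>R d (p $ 2)) + q $ 1 *\<^sub>R boundary_point h (p $ 2)"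
    for p q :: "real^2"
  have der: "(G has_derivative G' p) (at p within S)" for p
  proof -
    have nth: "((\<lambda>p. p $ i) has_derivative (\<lambda>q. q $ i)) (at p within S)" for i :: 2
      by (rule bounded_linear_imp_has_derivative) (rule bounded_linear_vec_nth)
    have "(boundary_point h has_derivative (\<lambda>x. x *\<^sub>R d (p $ 2))) (at (p $ 2))"
      using boundary_point_deriv[OF H(1), of "p $ 2"] unfolding has_vector_derivative_def d_def .
    from has_derivative_compose[OF nth this]
    show ?thesis unfolding G_def[abs_def] G'_def[abs_def] by (rule has_derivative_scaleR[OF nth])
  qed
  have det: "\<bar>det (matrix (G' p))\<bar> = p $ 1 * (h (p $ 2) * curv_radius h (p $ 2))" if "p \<in> S" for p
  proof -
    let ?\<theta> = "p $ 2"
    have "p $ 1 * (h ?\<theta> * curv_radius h ?\<theta>) \<ge> 0" using that H(2,3)[of ?\<theta>] unfolding S_def by simp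
    \<comment> \<open>The tangential part of the boundary point does not contribute to the
      determinant; its normal part is h.\<close>
    moreover have "det (matrix (G' p)) = p $ 1 * curv_radius h ?\<theta> * (unit_vec ?\<theta> \<bullet> boundary_point h ?\<theta>)"
      unfolding det_2 matrix_def inner_unit_vec G'_def d_def
      by (simp add: axis_def algebra_simps)
    ultimately show ?thesis by (simp add: mult_ac)
  qed
  have inj: "inj_on G S"
  proof (rule inj_onI)
    fix p q assume "p \<in> S" "q \<in> S" "G p = G q"
    then have *: "0 < p $ 1" "0 < q $ 1" "p $ 2 \<in> {0..<2 * pi}" "q $ 2 \<in> {0..<2 * pi}"
      "p $ 1 *\<^sub>R boundary_point h (p $ 2) = q $ 1 *\<^sub>R boundary_point h (q $ 2)"
      by (auto simp: S_def G_def)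
    note eq = scaled_boundary_point_inj[OF *(1,2,5)]
    from inj_onD[OF boundary_point_inj_on eq(2) *(3,4)] eq(1)
    show "p = q" by (simp add: vec_eq_iff forall_2)
  qed
  have image: "insert 0 (G ` S) = K"
  proof
    have "0 \<in> K"
      using mem_iff_support_angle[OF K'(1,3,2), of 0] H(2) less_imp_le unfolding h_def by auto
    moreover have "G p \<in> K" if "p \<in> S" for p
      using convexD_alt[OF K'(2) \<open>0 \<in> K\<close> boundary_point_mem, of "p $ 1" "p $ 2"] that
      by (simp add: S_def G_def)
    ultimately show "insert 0 (G ` S) \<subseteq> K" by blast
    show "K \<subseteq> insert 0 (G ` S)"
    proof
      fix x assume "x \<in> K"
      show "x \<in> insert 0 (G ` S)"
      proof (cases "x = 0")
        case False
        from scaled_boundary_point_surj[OF \<open>x \<in> K\<close> this] obtain s \<theta>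
          where "0 < s" "s \<le> 1" "0 \<le> \<theta>" "\<theta> < 2 * pi" "x = s *\<^sub>R boundary_point h \<theta>" .
        then show ?thesis
          by (intro insertI2 image_eqI[of _ _ "vector [s, \<theta>]"]) (simp_all add: S_def G_def)
      qed simp
    qed
  qed
  have meas: "S \<in> sets lebesgue"
  proof -
    have "open {p :: real^2. 0 < p $ 1 \<and> p $ 2 < 2 * pi}" "closed {p :: real^2. p $ 1 \<le> 1 \<and> 0 \<le> p $ 2}"
      by (auto intro!: open_Collect_conj open_Collect_less closed_Collect_conj closed_Collect_le
          continuous_intros)
    then have "{p :: real^2. 0 < p $ 1 \<and> p $ 2 < 2 * pi} \<inter> {p. p $ 1 \<le> 1 \<and> 0 \<le> p $ 2} \<in> sets borel"
      by (intro sets.Int borel_open borel_closed)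
    also have "{p :: real^2. 0 < p $ 1 \<and> p $ 2 < 2 * pi} \<inter> {p. p $ 1 \<le> 1 \<and> 0 \<le> p $ 2} = S"
      by (auto simp: S_def)
    finally show ?thesis by auto
  qed
  have "((\<lambda>p. p $ 1 * (h (p $ 2) * curv_radius h (p $ 2))) has_integral
      integral {0..1} (\<lambda>x. x) * integral {0..2 * pi} (\<lambda>x. h x * curv_radius h x))
      (cbox (vector [0, 0] :: real^2) (vector [1, 2 * pi]))"
    by (rule has_integral_product_vec2) (intro continuous_intros C2_periodic_continuous_intros H)+
  also have "integral {0..1} (\<lambda>x. x) * integral {0..2 * pi} (\<lambda>x. h x * curv_radius h x) = mixed_area h h"
    using ident_has_integral[of 0 "1 :: real"] by (simp add: mixed_area_def has_integral_iff)
  \<comment> \<open>S and the closed rectangle differ only inside the frontier of the rectangle, a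
    null set.\<close>
  finally have "((\<lambda>p. p $ 1 * (h (p $ 2) * curv_radius h (p $ 2))) has_integral mixed_area h h) S"
  proof (rule has_integral_spike_set_eq[THEN iffD1, rotated 2])
    have box: "box (vector [0, 0]) (vector [1, 2 * pi]) \<subseteq> S" "S \<subseteq> cbox (vector [0, 0]) (vector [1, 2 * pi])"
      by (auto simp: S_def mem_box_cart forall_2)
    show "negligible {x \<in> cbox (vector [0, 0]) (vector [1, 2 * pi]) - S.
        x $ 1 * (h (x $ 2) * curv_radius h (x $ 2)) \<noteq> 0}"
      by (rule negligible_subset[OF negligible_frontier_interval]) (use box in blast)
    show "negligible {x \<in> S - cbox (vector [0, 0]) (vector [1, 2 * pi]).
        x $ 1 * (h (x $ 2) * curv_radius h (x $ 2)) \<noteq> 0}"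
      using box(2) by (simp add: Diff_eq_empty_iff[THEN iffD2])
  qed
  then have int: "((\<lambda>p. \<bar>det (matrix (G' p))\<bar>) has_integral mixed_area h h) S"
    by (rule has_integral_eq[rotated]) (simp add: det)
  have "measure lebesgue (G ` S) = mixed_area h h"
    using measure_differentiable_image_eq[OF meas der inj has_integral_integrable[OF int]]
      integral_unique[OF int] by simp
  moreover have "measure lebesgue (G ` S) = measure lebesgue K"
  proof (rule measure_negligible_symdiff[OF lmeasurable_compact[OF K'(1)]])
    show "negligible (K - G ` S \<union> (G ` S - K))"
      by (rule negligible_subset[of "{0}"]) (use image in auto)
  qed
  ultimately show ?thesis by simp
qed

end

section \<open>Integration with respect to the cone-volume measure\<close>

lemma sphere_eq_unit_vec: "sphere (0 :: real^2) 1 = unit_vec ` {0..2 * pi}"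
proof (rule set_eqI)
  fix u :: "real^2"
  have "u \<in> unit_vec ` {0..2 * pi}" if u: "norm u = 1"
  proof -
    obtain \<theta> where "u = norm u *\<^sub>R unit_vec \<theta>" by (rule polar_decomposition)
    then have "u = unit_vec \<theta>" using u by simp
    moreover obtain \<phi> where "0 \<le> \<phi>" "\<phi> < 0 + 2 * pi" "unit_vec \<phi> = unit_vec \<theta>"
      using periodic_range[of unit_vec] unit_vec_periodic by metis
    ultimately show ?thesis by (intro image_eqI[of _ _ \<phi>]) auto
  qed
  then show "u \<in> sphere 0 1 \<longleftrightarrow> u \<in> unit_vec ` {0..2 * pi}" by auto
qed

lemma continuous_on_unit_vec: "continuous_on S unit_vec"
proof -
  have "unit_vec = (\<lambda>\<theta>. \<chi> i. if i = 1 then cos \<theta> else sin \<theta>)"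
    by (auto simp: fun_eq_iff vec_eq_iff forall_2)
  moreover have "continuous_on S (\<lambda>\<theta>. \<chi> i :: 2. if i = 1 then cos \<theta> else sin \<theta>)"
  proof (rule continuous_on_vec_lambda)
    show "continuous_on S (\<lambda>\<theta>. if i = 1 then cos \<theta> else sin \<theta>)" for i :: 2
      by (cases "i = 1") (auto intro!: continuous_intros)
  qed
  ultimately show ?thesis by (simp only:)
qed

text \<open>The angle map from the compact interval onto the circle is closed, hence a quotient map.
  This gives measurability of functions such as the curvature, which are understood only as
  functions of the angle.\<close>

lemma continuous_on_sphereI:
  fixes f :: "real^2 \<Rightarrow> real"
  assumes "continuous_on UNIV (\<lambda>\<theta>. f (unit_vec \<theta>))"
  shows "continuous_on (sphere 0 1) f"
proof (subst continuous_on_closed_vimage)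
  show "\<forall>B. closed B \<longrightarrow> closed (f -` B \<inter> sphere 0 1)"
  proof (intro allI impI)
    fix B :: "real set" assume "closed B"
    let ?C = "(\<lambda>\<theta>. f (unit_vec \<theta>)) -` B \<inter> {0..2 * pi}"
    have "closed ?C"
      using continuous_on_closed_vimage[of "{0..2 * pi}" "\<lambda>\<theta>. f (unit_vec \<theta>)"]
        continuous_on_subset[OF assms, of "{0..2 * pi}"] \<open>closed B\<close> by auto
    then have "compact ?C" by (simp add: compact_eq_bounded_closed bounded_subset[of "{0..2 * pi}"])
    then have "compact (unit_vec ` ?C)"
      by (rule compact_continuous_image[OF continuous_on_unit_vec])
    moreover have "unit_vec ` ?C = f -` B \<inter> sphere 0 1"
      unfolding sphere_eq_unit_vec by auto
    ultimately show "closed (f -` B \<inter> sphere 0 1)" by (simp add: compact_imp_closed)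
  qed
qed simp

lemma integral_cone_volume_measure:
  assumes h: "regular_support (support_angle K)"
    and F: "continuous_on UNIV (\<lambda>\<theta>. F (unit_vec \<theta>))"
  shows "(\<integral>u. F u \<partial>cone_volume_measure K) = cone_integral (support_angle K) (\<lambda>\<theta>. F (unit_vec \<theta>))"
proof -
  let ?h = "support_angle K"
  note H = regular_supportD[OF h]
  let ?M = "restrict_space lborel {0..<2 * pi}"
  let ?D = "density ?M (\<lambda>\<theta>. ennreal (curv_radius ?h \<theta>))"
  have measurable: "f \<in> borel_measurable circle" if "continuous_on UNIV (\<lambda>\<theta>. f (unit_vec \<theta>))" for f :: "real^2 \<Rightarrow> real"
    unfolding circle_def
    by (rule borel_measurable_continuous_on_restrict) (rule continuous_on_sphereI[OF that])
  have K: "(\<lambda>u. support_fun K u / 2) \<in> borel_measurable circle"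
    by (rule measurable)
      (intro continuous_intros C2_periodic_continuous H(1)[unfolded support_angle_def], simp)
  have FK: "(\<lambda>u. (support_fun K u / 2) *\<^sub>R F u) \<in> borel_measurable circle"
    by (rule measurable)
      (intro continuous_intros F C2_periodic_continuous H(1)[unfolded support_angle_def], simp)
  have meas: "f \<in> borel_measurable ?M" if "continuous_on UNIV f" for f :: "real \<Rightarrow> real"
    using borel_measurable_continuous_onI[OF that] by (intro measurable_restrict_space1) simp
  have unit_vec: "unit_vec \<in> measurable ?D circle"
  proof -
    have "unit_vec \<in> borel_measurable ?M"
      using borel_measurable_continuous_onI[OF continuous_on_unit_vec]
      by (intro measurable_restrict_space1) simp
    then show ?thesis
      unfolding circle_def by (intro measurable_restrict_space2) auto
  qed
  have S: "surface_area_measure K = distr ?D circle unit_vec"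
    unfolding surface_area_measure_def curv_radius_def ..
  have "space circle = unit_vec ` {0..2 * pi}"
    unfolding circle_def sphere_eq_unit_vec[symmetric] by (simp add: space_restrict_space)
  then have "AE u in surface_area_measure K. 0 \<le> support_fun K u / 2"
    using H(2) unfolding S support_angle_def by (intro AE_I2) (auto intro: less_imp_le)
  then have "(\<integral>u. F u \<partial>cone_volume_measure K)
      = (\<integral>u. (support_fun K u / 2) *\<^sub>R F u \<partial>surface_area_measure K)"
    unfolding cone_volume_measure_def
    by (intro integral_density) (use measurable[OF F] K in \<open>auto simp: S\<close>)
  also have "\<dots> = (\<integral>\<theta>. (?h \<theta> / 2) *\<^sub>R F (unit_vec \<theta>) \<partial>?D)"
    unfolding S integral_distr[OF unit_vec FK] by (simp add: support_angle_def)
  also have "\<dots> = (\<integral>\<theta>. curv_radius ?h \<theta> *\<^sub>R ((?h \<theta> / 2) *\<^sub>R F (unit_vec \<theta>)) \<partial>?M)"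
  proof (intro integral_density meas AE_I2)
    show "continuous_on UNIV (\<lambda>\<theta>. (?h \<theta> / 2) *\<^sub>R F (unit_vec \<theta>))"
      by (intro continuous_intros F C2_periodic_continuous H, simp)
  qed (auto intro: C2_periodic_continuous_curv_radius H less_imp_le)
  also have "\<dots> = (\<integral>\<theta>\<in>{0..<2 * pi}. curv_radius ?h \<theta> *\<^sub>R ((?h \<theta> / 2) *\<^sub>R F (unit_vec \<theta>)) \<partial>lborel)"
    unfolding set_lebesgue_integral_def by (rule integral_restrict_space) simp
  also have "\<dots> = integral {0..<2 * pi} (\<lambda>\<theta>. curv_radius ?h \<theta> *\<^sub>R ((?h \<theta> / 2) *\<^sub>R F (unit_vec \<theta>)))"
  proof (rule set_borel_integral_eq_integral(2))
    have "set_integrable lborel {0..2 * pi} (\<lambda>\<theta>. curv_radius ?h \<theta> *\<^sub>R ((?h \<theta> / 2) *\<^sub>R F (unit_vec \<theta>)))"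
      by (intro borel_integrable_atLeastAtMost' continuous_intros continuous_on_subset[OF F]
          C2_periodic_continuous_intros H) auto
    then show "set_integrable lborel {0..<2 * pi} (\<lambda>\<theta>. curv_radius ?h \<theta> *\<^sub>R ((?h \<theta> / 2) *\<^sub>R F (unit_vec \<theta>)))"
      by (rule set_integrable_subset) auto
  qed
  also have "\<dots> = integral {0..2 * pi} (\<lambda>\<theta>. curv_radius ?h \<theta> *\<^sub>R ((?h \<theta> / 2) *\<^sub>R F (unit_vec \<theta>)))"
    by (rule integral_spike_set; rule negligible_subset[of "{2 * pi}"]) auto
  also have "\<dots> = cone_integral ?h (\<lambda>\<theta>. F (unit_vec \<theta>))"
    unfolding cone_integral_def integral_divide[symmetric]
    by (rule arg_cong[of _ _ "integral _"]) (simp add: fun_eq_iff mult_ac)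
  finally show ?thesis .
qed

section \<open>Contact points in dilation position\<close>

text \<open>Subtracting a small multiple of the cosine centred on the arc costs at most half the
  minimum of g there, while on the complementary open arc the cosine is negative and the difference
  gains. Compactness of a period makes the positive lower bound uniform.\<close>

lemma half_circle_shift:
  assumes cont: "continuous_on UNIV g" and per: "\<And>\<theta>. g (\<theta> + 2 * pi) = g \<theta>"
    and nonneg: "\<And>\<theta>. g \<theta> \<ge> 0" and pos: "\<And>\<theta>. \<theta> \<in> {\<alpha>..\<alpha> + pi} \<Longrightarrow> g \<theta> > 0"
  shows "\<exists>x \<delta>. \<delta> > 0 \<and> (\<forall>\<theta>. g \<theta> - unit_vec \<theta> \<bullet> x \<ge> \<delta>)"
proof -
  have contg: "continuous_on S g" for S using cont continuous_on_subset by blast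
  obtain m where m: "m \<in> {\<alpha>..\<alpha> + pi}" "\<And>\<theta>. \<theta> \<in> {\<alpha>..\<alpha> + pi} \<Longrightarrow> g m \<le> g \<theta>"
    using continuous_attains_inf[of "{\<alpha>..\<alpha> + pi}" g] contg by auto
  \<comment> \<open>A translation towards the midpoint of the arc, by half the minimum of g on
    it.\<close>
  define x where "x = (g m / 2) *\<^sub>R unit_vec (\<alpha> + pi / 2)"
  define f where "f \<theta> = g \<theta> - unit_vec \<theta> \<bullet> x" for \<theta>
  have f: "f \<theta> = g \<theta> - g m / 2 * cos (\<theta> - (\<alpha> + pi / 2))" for \<theta>
    unfolding f_def x_def inner_scaleR_right inner_unit_vec unit_vec_nth cos_diff ..
  have pos_f: "f \<theta> > 0" if \<theta>: "\<alpha> \<le> \<theta>" "\<theta> < \<alpha> + 2 * pi" for \<theta>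
  proof (cases "\<theta> \<le> \<alpha> + pi")
    case True
    have "g m / 2 * cos (\<theta> - (\<alpha> + pi / 2)) \<le> g m / 2 * 1"
      using pos[OF m(1)] by (intro mult_left_mono) auto
    moreover have "g m \<le> g \<theta>" using m(2)[of \<theta>] True \<theta> by simp
    ultimately show ?thesis using pos[OF m(1)] unfolding f by linarith
  next
    case False
    have "cos (\<theta> - (\<alpha> + pi / 2) - pi) > 0" using False \<theta> by (intro cos_gt_zero_pi) auto
    then have "cos (\<theta> - (\<alpha> + pi / 2)) < 0"
      unfolding cos_diff[of "\<theta> - (\<alpha> + pi / 2)" pi] cos_pi sin_pi by linarith
    then have "g m / 2 * cos (\<theta> - (\<alpha> + pi / 2)) < 0" using pos[OF m(1)] by (intro mult_pos_neg) auto
    then show ?thesis using nonneg[of \<theta>] unfolding f by simp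
  qed
  have f_per: "f (\<theta> + 2 * pi) = f \<theta>" for \<theta> unfolding f_def by (simp add: per)
  have red: "\<exists>y\<in>{\<alpha>..\<alpha> + 2 * pi}. f y = f \<theta> \<and> f y > 0" for \<theta>
  proof -
    obtain y where "\<alpha> \<le> y" "y < \<alpha> + 2 * pi" "f y = f \<theta>" using periodic_range[of f] f_per by metis
    then show ?thesis using pos_f[of y] by (intro bexI[of _ y]) auto
  qed
  have "continuous_on {\<alpha>..\<alpha> + 2 * pi} f" unfolding f by (intro continuous_intros contg)
  then obtain n where n: "n \<in> {\<alpha>..\<alpha> + 2 * pi}" "\<And>\<theta>. \<theta> \<in> {\<alpha>..\<alpha> + 2 * pi} \<Longrightarrow> f n \<le> f \<theta>"
    using continuous_attains_inf[of "{\<alpha>..\<alpha> + 2 * pi}" f] by auto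
  show ?thesis
  proof (intro exI conjI allI)
    show "f n > 0" using red[of n] n by fastforce
    show "f n \<le> g \<theta> - unit_vec \<theta> \<bullet> x" for \<theta>
      using red[of \<theta>] n(2) unfolding f_def[symmetric] by metis
  qed
qed

lemma C2_periodic_attains:
  assumes "C2_periodic f"
  obtains m M where "\<And>\<theta>. f m \<le> f \<theta>" "\<And>\<theta>. f \<theta> \<le> f M"
proof -
  have cont: "continuous_on {0..2 * pi} f" by (rule C2_periodic_continuous[OF assms])
  have ne: "{0..2 * pi} \<noteq> {}" by simp
  obtain m where m: "\<And>\<theta>. \<theta> \<in> {0..2 * pi} \<Longrightarrow> f m \<le> f \<theta>"
    using continuous_attains_inf[OF compact_Icc ne cont] by blast
  obtain M where M: "\<And>\<theta>. \<theta> \<in> {0..2 * pi} \<Longrightarrow> f \<theta> \<le> f M"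
    using continuous_attains_sup[OF compact_Icc ne cont] by blast
  have red: "\<exists>y\<in>{0..2 * pi}. f y = f \<theta>" for \<theta>
  proof -
    obtain y where "0 \<le> y" "y < 0 + 2 * pi" "f y = f \<theta>"
      using periodic_range[of f] C2_periodic_shift[OF assms] by metis
    then show ?thesis by (intro bexI[of _ y]) auto
  qed
  show ?thesis by (rule that[of m M]) (use m M red in metis)+
qed

text \<open>An arc of length \<pi> without contact would let \<open>half_circle_shift\<close> create
  uniform room after a translation, enough to enlarge r or to shrink R, against their extremality.
  The bounds on \<open>Sup\<close> and \<open>Inf\<close> needed to use that extremality are derived
  first.\<close>

lemma dilation_touching:
  assumes "(K, L) \<in> admissible_pairs"
  obtains r R where "r > 0"
    "\<And>\<theta>. r * support_angle L \<theta> \<le> support_angle K \<theta>" "\<And>\<theta>. support_angle K \<theta> \<le> R * support_angle L \<theta>"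
    "touching (support_angle K) (support_angle L) r" "touching (support_angle K) (support_angle L) R"
proof -
  have adm: "admissible_body K" "admissible_body L" and pos: "dilation_position K L"
    using assms unfolding admissible_pairs_def by auto
  then have K: "convex_body K" and L: "convex_body L" unfolding admissible_body_def by auto
  let ?a = "support_angle K" and ?b = "support_angle L"
  note A = regular_supportD[OF admissible_regular_support[OF adm(1)]]
    and B = regular_supportD[OF admissible_regular_support[OF adm(2)]]
  define r where "r = rel_inradius K L"
  define R where "R = rel_outradius K L"
  have in_K: "(\<lambda>y. 0 + r *\<^sub>R y) ` L \<subseteq> K" and K_in: "K \<subseteq> (\<lambda>y. 0 + R *\<^sub>R y) ` L"
    using pos unfolding dilation_position_def r_def R_def by simp_all
  let ?I = "{t. t > 0 \<and> (\<exists>x. (\<lambda>y. x + t *\<^sub>R y) ` L \<subseteq> K)}"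
  let ?O = "{t. t > 0 \<and> (\<exists>x. K \<subseteq> (\<lambda>y. x + t *\<^sub>R y) ` L)}"
  have width: "?b 0 + ?b pi > 0" using B(2)[of 0] B(2)[of pi] by simp
  have bdd_I: "bdd_above ?I"
  proof (rule bdd_aboveI)
    fix t assume "t \<in> ?I"
    then obtain x where t: "\<And>\<theta>. unit_vec \<theta> \<bullet> x + t * ?b \<theta> \<le> ?a \<theta>"
      using subset_iff_support_angle[OF K L] by blast
    \<comment> \<open>Adding two opposite directions compares widths, and the unknown translation x
      cancels.\<close>
    have "t * (?b 0 + ?b pi) \<le> ?a 0 + ?a pi"
      using t[of 0] t[of pi] by (simp add: inner_unit_vec algebra_simps)
    then show "t \<le> (?a 0 + ?a pi) / (?b 0 + ?b pi)"
      using width by (simp add: pos_le_divide_eq)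
  qed
  have le_r: "t \<le> r" if "t > 0" "\<And>\<theta>. unit_vec \<theta> \<bullet> x + t * ?b \<theta> \<le> ?a \<theta>" for t x
  proof -
    have "t \<in> ?I" using that subset_iff_support_angle[OF K L, of t x] by blast
    then show ?thesis unfolding r_def rel_inradius_def by (rule cSup_upper[OF _ bdd_I])
  qed
  have in_O: "t \<in> ?O" if "t > 0" "\<And>\<theta>. ?a \<theta> \<le> unit_vec \<theta> \<bullet> x + t * ?b \<theta>" for t x
    using that supset_iff_support_angle[OF K L, of t x] by blast
  have bdd_O: "bdd_below ?O" by (rule bdd_belowI[of _ 0]) auto
  have R_le: "R \<le> t" if "t > 0" "\<And>\<theta>. ?a \<theta> \<le> unit_vec \<theta> \<bullet> x + t * ?b \<theta>" for t x
    unfolding R_def rel_outradius_def using in_O[OF that] by (rule cInf_lower[OF _ bdd_O])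
  obtain ma Ma where ma: "\<And>\<theta>. ?a ma \<le> ?a \<theta>" "\<And>\<theta>. ?a \<theta> \<le> ?a Ma"
    using C2_periodic_attains[OF A(1)] by metis
  obtain mb Mb where mb: "\<And>\<theta>. ?b mb \<le> ?b \<theta>" "\<And>\<theta>. ?b \<theta> \<le> ?b Mb"
    using C2_periodic_attains[OF B(1)] by metis
  have r: "r > 0"
  proof -
    have "?a ma / ?b Mb \<le> r"
    proof (rule le_r[of _ 0])
      show "?a ma / ?b Mb > 0" using A(2) B(2) by simp
      show "unit_vec \<theta> \<bullet> 0 + ?a ma / ?b Mb * ?b \<theta> \<le> ?a \<theta>" for \<theta>
      proof -
        have "?a ma / ?b Mb * ?b \<theta> \<le> ?a ma / ?b Mb * ?b Mb"
          using A(2)[of ma] B(2)[of Mb] mb(2)[of \<theta>] by (intro mult_left_mono) auto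
        then show ?thesis using ma(1)[of \<theta>] B(2)[of Mb] by simp
      qed
    qed
    moreover have "?a ma / ?b Mb > 0" using A(2) B(2) by simp
    ultimately show ?thesis by linarith
  qed
  have R: "R > 0"
  proof -
    have "?a Ma / ?b mb \<in> ?O"
    proof (rule in_O[of _ 0])
      show "?a Ma / ?b mb > 0" using A(2) B(2) by simp
      show "?a \<theta> \<le> unit_vec \<theta> \<bullet> 0 + ?a Ma / ?b mb * ?b \<theta>" for \<theta>
      proof -
        have "?a Ma / ?b mb * ?b mb \<le> ?a Ma / ?b mb * ?b \<theta>"
          using A(2)[of Ma] B(2)[of mb] mb(1)[of \<theta>] by (intro mult_left_mono) auto
        then show ?thesis using ma(2)[of \<theta>] B(2)[of mb] by simp
      qed
    qed
    then have "(?a 0 + ?a pi) / (?b 0 + ?b pi) \<le> R"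
      unfolding R_def rel_outradius_def
    proof (intro cInf_greatest)
      fix t assume "t \<in> ?O"
      then obtain x where t: "\<And>\<theta>. ?a \<theta> \<le> unit_vec \<theta> \<bullet> x + t * ?b \<theta>"
        using supset_iff_support_angle[OF K L] by blast
      have "?a 0 + ?a pi \<le> t * (?b 0 + ?b pi)"
        using t[of 0] t[of pi] by (simp add: inner_unit_vec algebra_simps)
      then show "(?a 0 + ?a pi) / (?b 0 + ?b pi) \<le> t"
        using width by (simp add: pos_divide_le_eq)
    qed blast
    moreover have "(?a 0 + ?a pi) / (?b 0 + ?b pi) > 0"
      using width A(2)[of 0] A(2)[of pi] by simp
    ultimately show ?thesis by linarith
  qed
  have lower: "r * ?b \<theta> \<le> ?a \<theta>" for \<theta>
    using in_K[unfolded subset_iff_support_angle[OF K L r]] by simp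
  have upper: "?a \<theta> \<le> R * ?b \<theta>" for \<theta>
    using K_in[unfolded supset_iff_support_angle[OF K L R]] by simp
  have touch_r: "touching ?a ?b r"
    unfolding touching_def
  proof (rule ccontr)
    assume "\<not> (\<forall>\<alpha>. \<exists>z\<in>{\<alpha>..\<alpha> + pi}. ?a z = r * ?b z)"
    then obtain \<alpha> where \<alpha>: "\<And>z. z \<in> {\<alpha>..\<alpha> + pi} \<Longrightarrow> ?a z \<noteq> r * ?b z" by blast
    have "\<exists>x \<delta>. \<delta> > 0 \<and> (\<forall>\<theta>. ?a \<theta> - r * ?b \<theta> - unit_vec \<theta> \<bullet> x \<ge> \<delta>)"
    proof (rule half_circle_shift[of "\<lambda>\<theta>. ?a \<theta> - r * ?b \<theta>" \<alpha>])
      show "continuous_on UNIV (\<lambda>\<theta>. ?a \<theta> - r * ?b \<theta>)"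
        by (intro continuous_intros C2_periodic_continuous A B)
      show "?a \<theta> - r * ?b \<theta> > 0" if "\<theta> \<in> {\<alpha>..\<alpha> + pi}" for \<theta>
        using \<alpha>[OF that] lower[of \<theta>] by simp
    qed (use lower in \<open>simp_all add: support_angle_periodic\<close>)
    then obtain x \<delta> where \<delta>: "\<delta> > 0" "\<And>\<theta>. ?a \<theta> - r * ?b \<theta> - unit_vec \<theta> \<bullet> x \<ge> \<delta>"
      by blast
    \<comment> \<open>Division by the maximum of \<open>?b\<close> turns the uniform room \<delta>
      into an admissible increase of the scaling factor.\<close>
    have "r + \<delta> / ?b Mb \<le> r"
    proof (rule le_r[of _ x])
      show "unit_vec \<theta> \<bullet> x + (r + \<delta> / ?b Mb) * ?b \<theta> \<le> ?a \<theta>" for \<theta>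
      proof -
        have "\<delta> / ?b Mb * ?b \<theta> \<le> \<delta> / ?b Mb * ?b Mb"
          using \<delta>(1) B(2)[of Mb] mb(2)[of \<theta>] by (intro mult_left_mono) auto
        then show ?thesis using \<delta>(2)[of \<theta>] B(2)[of Mb] by (simp add: distrib_right)
      qed
    qed (use r \<delta>(1) B(2)[of Mb] in \<open>simp add: add_pos_pos\<close>)
    moreover have "\<delta> / ?b Mb > 0" using \<delta>(1) B(2) by simp
    ultimately show False by linarith
  qed
  have touch_R: "touching ?a ?b R"
    unfolding touching_def
  proof (rule ccontr)
    assume "\<not> (\<forall>\<alpha>. \<exists>z\<in>{\<alpha>..\<alpha> + pi}. ?a z = R * ?b z)"
    then obtain \<alpha> where \<alpha>: "\<And>z. z \<in> {\<alpha>..\<alpha> + pi} \<Longrightarrow> ?a z \<noteq> R * ?b z" by blast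
    have "\<exists>x \<delta>. \<delta> > 0 \<and> (\<forall>\<theta>. R * ?b \<theta> - ?a \<theta> - unit_vec \<theta> \<bullet> x \<ge> \<delta>)"
    proof (rule half_circle_shift[of "\<lambda>\<theta>. R * ?b \<theta> - ?a \<theta>" \<alpha>])
      show "continuous_on UNIV (\<lambda>\<theta>. R * ?b \<theta> - ?a \<theta>)"
        by (intro continuous_intros C2_periodic_continuous A B)
      show "R * ?b \<theta> - ?a \<theta> > 0" if "\<theta> \<in> {\<alpha>..\<alpha> + pi}" for \<theta>
        using \<alpha>[OF that] upper[of \<theta>] by simp
    qed (use upper in \<open>simp_all add: support_angle_periodic\<close>)
    then obtain x \<delta> where \<delta>: "\<delta> > 0" "\<And>\<theta>. R * ?b \<theta> - ?a \<theta> - unit_vec \<theta> \<bullet> x \<ge> \<delta>"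
      by blast
    \<comment> \<open>The cap R / 2 keeps the decreased factor R - \<epsilon> positive, as
      membership in the set under the infimum requires.\<close>
    define \<epsilon> where "\<epsilon> = min (\<delta> / ?b Mb) (R / 2)"
    have "\<epsilon> > 0" unfolding \<epsilon>_def using \<delta>(1) B(2)[of Mb] R by simp
    moreover have "\<epsilon> \<le> R / 2" "\<epsilon> \<le> \<delta> / ?b Mb"
      unfolding \<epsilon>_def by (rule min.cobounded2, rule min.cobounded1)
    ultimately have \<epsilon>: "\<epsilon> > 0" "\<epsilon> \<le> R / 2" "\<epsilon> \<le> \<delta> / ?b Mb" .
    have "R \<le> R - \<epsilon>"
    proof (rule R_le[of _ "- x"])
      show "?a \<theta> \<le> unit_vec \<theta> \<bullet> - x + (R - \<epsilon>) * ?b \<theta>" for \<theta>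
      proof -
        have "\<epsilon> * ?b \<theta> \<le> \<delta> / ?b Mb * ?b Mb"
          using \<epsilon> B(2)[of \<theta>] mb(2)[of \<theta>] \<delta>(1) by (intro mult_mono) auto
        then show ?thesis using \<delta>(2)[of \<theta>] B(2)[of Mb] by (simp add: left_diff_distrib)
      qed
    qed (use \<epsilon> R in simp)
    then show False using \<epsilon>(1) by simp
  qed
  show ?thesis by (rule that[OF r lower upper touch_r touch_R])
qed

section \<open>The three equivalent statements\<close>

text \<open>A translation by x adds \<open>unit_vec \<theta> \<bullet> x\<close>, which lies in the
  kernel of f + f''. It therefore contributes nothing to the radius of curvature and has mixed area
  0 with \<open>b\<close> and with itself.\<close>

lemma homothetic_entropy_eq:
  assumes a: "regular_support a" and b: "regular_support b" and c: "c > 0"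
    and eq: "\<And>\<theta>. a \<theta> = c * b \<theta> + unit_vec \<theta> \<bullet> x"
  shows "cone_integral a (\<lambda>x. ln (curv_radius b x / curv_radius a x))
      = mixed_area a a / 2 * ln (mixed_area b b / mixed_area a a)"
proof -
  define e where "e \<theta> = unit_vec \<theta> \<bullet> x" for \<theta>
  have e: "C2_periodic e" and "deriv (deriv e) = (\<lambda>\<theta>. - (unit_vec \<theta> \<bullet> x))"
  proof -
    have 1: "(e has_real_derivative - sin \<theta> * x $ 1 + cos \<theta> * x $ 2) (at \<theta>)"
      and 2: "((\<lambda>\<theta>. - sin \<theta> * x $ 1 + cos \<theta> * x $ 2) has_real_derivative - (unit_vec \<theta> \<bullet> x)) (at \<theta>)" for \<theta>
      unfolding e_def inner_unit_vec by (auto intro!: derivative_eq_intros)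
    have 3: "continuous_on UNIV (\<lambda>\<theta>. - (unit_vec \<theta> \<bullet> x))"
      by (intro continuous_intros continuous_on_unit_vec)
    have 4: "e (\<theta> + 2 * pi) = e \<theta>" for \<theta> by (simp add: e_def)
    show "C2_periodic e" "deriv (deriv e) = (\<lambda>\<theta>. - (unit_vec \<theta> \<bullet> x))"
      by (rule C2_periodicI[OF 1 2 3 4])+
  qed
  then have e0: "curv_radius e \<theta> = 0" for \<theta> by (simp add: curv_radius_def e_def)
  note B = regular_supportD(1)[OF b]
  have a_eq: "a = (\<lambda>\<theta>. c * b \<theta> + 1 * e \<theta>)" using eq by (simp add: fun_eq_iff e_def)
  have "mixed_area b e = 0" "mixed_area e e = 0" unfolding mixed_area_def e0 by simp_all
  then have "mixed_area a a = c\<^sup>2 * mixed_area b b"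
    unfolding a_eq mixed_area_lincomb_self[OF B e] by simp
  moreover have "curv_radius a \<theta> = c * curv_radius b \<theta>" for \<theta>
    unfolding a_eq C2_periodic_lincomb(2)[OF B e] e0 by simp
  ultimately show ?thesis using entropy_eqI[OF a b c] by blast
qed

section \<open>Translation of the statements for functions back to pairs of bodies\<close>

context
  fixes K L :: "(real^2) set"
  assumes KL: "(K, L) \<in> admissible_pairs"
begin

lemma admissible_pairD:
  shows "admissible_body K" "admissible_body L" "convex_body K" "convex_body L"
    "regular_support (support_angle K)" "regular_support (support_angle L)"
proof -
  show *: "admissible_body K" "admissible_body L" using KL unfolding admissible_pairs_def by auto
  then show "convex_body K" "convex_body L" unfolding admissible_body_def by auto
  show "regular_support (support_angle K)" "regular_support (support_angle L)"
    using * admissible_regular_support by auto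
qed

lemma area_eq:
  "measure lebesgue K = mixed_area (support_angle K) (support_angle K)"
  "measure lebesgue L = mixed_area (support_angle L) (support_angle L)"
  using area_support_angle[OF _ refl] admissible_pairD by auto

lemma integral_log_support:
  "(\<integral>u. ln (support_fun L u / support_fun K u) \<partial>cone_volume_measure K)
    = cone_integral (support_angle K) (\<lambda>\<theta>. ln (support_angle L \<theta> / support_angle K \<theta>))"
proof -
  note A = regular_supportD[OF admissible_pairD(5)] and B = regular_supportD[OF admissible_pairD(6)]
  have "support_angle K \<theta> \<noteq> 0" "support_angle L \<theta> \<noteq> 0" for \<theta> using A(2)[of \<theta>] B(2)[of \<theta>] by auto
  then have "continuous_on UNIV (\<lambda>\<theta>. ln (support_angle L \<theta> / support_angle K \<theta>))"
    by (intro continuous_intros C2_periodic_continuous A B) auto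
  then show ?thesis
    using integral_cone_volume_measure[OF admissible_pairD(5)] by (simp add: support_angle_def)
qed

text \<open>Curvatures are reciprocals of radii, so the quotient inside the logarithm is K over L;
  the minus sign in the definition of the entropy inverts it.\<close>

lemma curvature_entropy_eq:
  "curvature_entropy K L = cone_integral (support_angle K)
    (\<lambda>\<theta>. ln (curv_radius (support_angle L) \<theta> / curv_radius (support_angle K) \<theta>))"
proof -
  let ?a = "support_angle K" and ?b = "support_angle L"
  note A = regular_supportD[OF admissible_pairD(5)] and B = regular_supportD[OF admissible_pairD(6)]
  have nz: "curv_radius ?a \<theta> \<noteq> 0" "curv_radius ?b \<theta> \<noteq> 0" for \<theta> using A(3)[of \<theta>] B(3)[of \<theta>] by auto
  have eq: "curvature L (unit_vec \<theta>) / curvature K (unit_vec \<theta>) = curv_radius ?a \<theta> / curv_radius ?b \<theta>" for \<theta>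
    by (simp add: curvature_unit_vec admissible_pairD)
  have "continuous_on UNIV (\<lambda>\<theta>. ln (curv_radius ?a \<theta> / curv_radius ?b \<theta>))"
    by (intro continuous_intros C2_periodic_continuous_curv_radius A B) (use nz in auto)
  then have "(\<integral>u. ln (curvature L u / curvature K u) \<partial>cone_volume_measure K)
      = cone_integral ?a (\<lambda>\<theta>. ln (curv_radius ?a \<theta> / curv_radius ?b \<theta>))"
    using integral_cone_volume_measure[OF admissible_pairD(5), of "\<lambda>u. ln (curvature L u / curvature K u)"]
    by (simp add: eq)
  moreover have "ln (curv_radius ?b \<theta> / curv_radius ?a \<theta>) = - ln (curv_radius ?a \<theta> / curv_radius ?b \<theta>)" for \<theta>
    using A(3)[of \<theta>] B(3)[of \<theta>] by (simp add: ln_div)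
  ultimately show ?thesis unfolding curvature_entropy_def by (simp add: cone_integral_def)
qed

lemma cone_volume_uniqueness:
  assumes eq: "cone_volume_measure K = cone_volume_measure L"
  shows "K = L"
proof -
  let ?a = "support_angle K" and ?b = "support_angle L"
  note A = admissible_pairD(5) and B = admissible_pairD(6)
  have b0: "?b \<theta> \<noteq> 0" for \<theta> using regular_supportD(2)[OF B, of \<theta>] by simp
  \<comment> \<open>Equality of the measures is exploited through integrals of functions continuous
    in the angle, here 1 and the quotient of the support functions.\<close>
  have same: "cone_integral ?a (\<lambda>\<theta>. F (unit_vec \<theta>)) = cone_integral ?b (\<lambda>\<theta>. F (unit_vec \<theta>))"
    if "continuous_on UNIV (\<lambda>\<theta>. F (unit_vec \<theta>))" for F
    using integral_cone_volume_measure[OF A that] integral_cone_volume_measure[OF B that] eq by simp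
  have "continuous_on UNIV (\<lambda>\<theta>. ?a \<theta> / ?b \<theta>)"
    by (intro continuous_intros C2_periodic_continuous regular_supportD(1) A B) (use b0 in auto)
  then have ratio: "cone_integral ?a (\<lambda>\<theta>. ?a \<theta> / ?b \<theta>) = cone_integral ?b (\<lambda>\<theta>. ?a \<theta> / ?b \<theta>)"
    using same[of "\<lambda>u. support_fun K u / support_fun L u"] by (simp add: support_angle_def)
  have mass: "cone_integral ?a (\<lambda>\<theta>. 1) = cone_integral ?b (\<lambda>\<theta>. 1)"
    using same[of "\<lambda>u. 1"] by simp
  obtain r R where rR: "r > 0" "\<And>\<theta>. r * ?b \<theta> \<le> ?a \<theta>" "\<And>\<theta>. ?a \<theta> \<le> R * ?b \<theta>"
    "touching ?a ?b r" "touching ?a ?b R"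
    using dilation_touching[OF KL] by metis
  have "?a \<theta> = ?b \<theta>" for \<theta>
    by (rule cone_integral_determines[OF A B rR(2,3,1,4,5) mass ratio])
  then show "K = L"
    using homothetic_iff_support_angle[OF admissible_pairD(3,4), of 1 0] by simp
qed

lemma volume_log_minkowski:
  shows "(\<integral>u. ln (support_fun L u / support_fun K u) \<partial>cone_volume_measure K)
      \<ge> measure lebesgue K / 2 * ln (measure lebesgue L / measure lebesgue K)"
    and "(\<integral>u. ln (support_fun L u / support_fun K u) \<partial>cone_volume_measure K)
      = measure lebesgue K / 2 * ln (measure lebesgue L / measure lebesgue K) \<longleftrightarrow> dilates K L"
proof -
  obtain r R where rR: "r > 0" "\<And>\<theta>. r * support_angle L \<theta> \<le> support_angle K \<theta>"
    "\<And>\<theta>. support_angle K \<theta> \<le> R * support_angle L \<theta>"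
    "touching (support_angle K) (support_angle L) r" "touching (support_angle K) (support_angle L) R"
    using dilation_touching[OF KL] by metis
  note * = log_minkowski[OF admissible_pairD(5,6) rR(2,3,1,4,5)]
  show "(\<integral>u. ln (support_fun L u / support_fun K u) \<partial>cone_volume_measure K)
      \<ge> measure lebesgue K / 2 * ln (measure lebesgue L / measure lebesgue K)"
    unfolding integral_log_support area_eq by (rule *)
  show "(\<integral>u. ln (support_fun L u / support_fun K u) \<partial>cone_volume_measure K)
      = measure lebesgue K / 2 * ln (measure lebesgue L / measure lebesgue K) \<longleftrightarrow> dilates K L"
    unfolding integral_log_support area_eq dilates_iff[OF admissible_pairD(3,4)] by (rule *)
qed

text \<open>The two directions of the equality case are asymmetric: equality yields a dilate, that
  is, a homothet with x = 0, while the converse starts from an arbitrary translation and uses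
  \<open>homothetic_entropy_eq\<close>.\<close>

lemma entropy_log_minkowski:
  shows "curvature_entropy K L \<le> measure lebesgue K / 2 * ln (measure lebesgue L / measure lebesgue K)"
    and "curvature_entropy K L = measure lebesgue K / 2 * ln (measure lebesgue L / measure lebesgue K)
      \<longleftrightarrow> homothetic K L"
proof -
  obtain r R where rR: "r > 0" "\<And>\<theta>. r * support_angle L \<theta> \<le> support_angle K \<theta>"
    "\<And>\<theta>. support_angle K \<theta> \<le> R * support_angle L \<theta>"
    "touching (support_angle K) (support_angle L) r" "touching (support_angle K) (support_angle L) R"
    using dilation_touching[OF KL] by metis
  note * = log_minkowski_entropy[OF admissible_pairD(5,6) rR(2,3,1,4,5)]
  show "curvature_entropy K L \<le> measure lebesgue K / 2 * ln (measure lebesgue L / measure lebesgue K)"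
    unfolding curvature_entropy_eq area_eq by (rule *)
  show "curvature_entropy K L = measure lebesgue K / 2 * ln (measure lebesgue L / measure lebesgue K)
      \<longleftrightarrow> homothetic K L"
    unfolding curvature_entropy_eq area_eq homothetic_iff[OF admissible_pairD(3,4)]
  proof
    assume "cone_integral (support_angle K)
        (\<lambda>\<theta>. ln (curv_radius (support_angle L) \<theta> / curv_radius (support_angle K) \<theta>))
      = mixed_area (support_angle K) (support_angle K) / 2 *
        ln (mixed_area (support_angle L) (support_angle L) / mixed_area (support_angle K) (support_angle K))"
    from *(2)[OF this] obtain c where "c > 0" "\<forall>\<theta>. support_angle K \<theta> = c * support_angle L \<theta>"
      by blast
    then show "\<exists>c>0. \<exists>x. \<forall>\<theta>. support_angle K \<theta> = c * support_angle L \<theta> + unit_vec \<theta> \<bullet> x"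
      by (intro exI[of _ c] conjI exI[of _ 0]) auto
  qed (use homothetic_entropy_eq[OF admissible_pairD(5,6)] in blast)
qed

end

theorem theorem3:
  shows
    "let uniqueness =
           (\<forall>(K, L) \<in> admissible_pairs.
              cone_volume_measure K = cone_volume_measure L \<longrightarrow> K = L);
         volume_inequality =
           (\<forall>(K, L) \<in> admissible_pairs.
              (\<integral>u. ln (support_fun L u / support_fun K u) \<partial>cone_volume_measure K)
                \<ge> measure lebesgue K / 2 * ln (measure lebesgue L / measure lebesgue K) \<and>
              ((\<integral>u. ln (support_fun L u / support_fun K u) \<partial>cone_volume_measure K)
                = measure lebesgue K / 2 * ln (measure lebesgue L / measure lebesgue K)
               \<longleftrightarrow> dilates K L));
         entropy_inequality =
           (\<forall>(K, L) \<in> admissible_pairs.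
              curvature_entropy K L
                \<le> measure lebesgue K / 2 * ln (measure lebesgue L / measure lebesgue K) \<and>
              (curvature_entropy K L
                = measure lebesgue K / 2 * ln (measure lebesgue L / measure lebesgue K)
               \<longleftrightarrow> homothetic K L))
     in (uniqueness \<longleftrightarrow> volume_inequality) \<and>
        (volume_inequality \<longleftrightarrow> entropy_inequality)"
proof -
  have uniqueness: "\<forall>(K, L) \<in> admissible_pairs. cone_volume_measure K = cone_volume_measure L \<longrightarrow> K = L"
    using cone_volume_uniqueness by blast
  have volume: "\<forall>(K, L) \<in> admissible_pairs.
      (\<integral>u. ln (support_fun L u / support_fun K u) \<partial>cone_volume_measure K)
        \<ge> measure lebesgue K / 2 * ln (measure lebesgue L / measure lebesgue K) \<and>
      ((\<integral>u. ln (support_fun L u / support_fun K u) \<partial>cone_volume_measure K)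
        = measure lebesgue K / 2 * ln (measure lebesgue L / measure lebesgue K) \<longleftrightarrow> dilates K L)"
    using volume_log_minkowski by blast
  have entropy: "\<forall>(K, L) \<in> admissible_pairs.
      curvature_entropy K L \<le> measure lebesgue K / 2 * ln (measure lebesgue L / measure lebesgue K) \<and>
      (curvature_entropy K L = measure lebesgue K / 2 * ln (measure lebesgue L / measure lebesgue K)
       \<longleftrightarrow> homothetic K L)"
    using entropy_log_minkowski by blast
  show ?thesis unfolding Let_def by (intro conjI iffI uniqueness volume entropy)
qed

end
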